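(* Let $N\ge 2$ and $q\ge 2$ be integers, $b=qN$, $\mathcal D=\{0,1,\ldots,N-1\}$ and $\mathcal C=(-\frac N2,\frac N2]\cap\mathbb Z$. Let $p_1,\ldots,p_m\ge 2N+1$ be distinct primes with $\gcd(p_1\cdots p_m,b)=1$. For $1\le i\le m$, let $l_i$ be the largest integer such that $p_i^{l_i}\mid\operatorname{lcm}\big(O_b(p_1),\ldots,O_b(p_m)\big)$. Assume that the integer $p_1^{\ell_b(p_1)+l_1}\cdots p_m^{\ell_b(p_m)+l_m}$ is a complete number of the spectral pair $(\mu_{b,q\mathcal D},\Lambda(b,\mathcal C))$. Then $p_1^{k_1}\cdots p_m^{k_m}$ is a complete number of this pair for any integers $k_1,\ldots,k_m\ge 0$.
   Context: For a positive integer $t$ with $\gcd(t,b)=1$, $O_b(t)$ is the multiplicative order of $b$ modulo $t$ (the least positive integer $\alpha$ with $b^\alpha\equiv1\pmod t$). For a prime $p\nmid b$, $\ell_b(p)$ is the largest positive integer $k$ such that $O_b(p^k)=O_b(p)$. For a finite set $B\subset\mathbb R$ and $\rho>1$, $\mu_{\rho,B}$ is the unique Borel probability measure on $\mathbb R$ with $\mu_{\rho,B}(\cdot)=\frac1{\#B}\sum_{a\in B}\mu_{\rho,B}\circ\phi_a^{-1}(\cdot)$, where $\phi_a(x)=\rho^{-1}(x+a)$. Put $q\mathcal D=\{qd:d\in\mathcal D\}$ and $\Lambda(b,\mathcal C)=\{\sum_{k=0}^n b^kc_k: n\ge 0,\ c_k\in\mathcal C\}$. A pair $(\mu,\Lambda)$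 of a compactly supported Borel probability measure on $\mathbb R$ and a countable set $\Lambda\subset\mathbb R$ is a spectral pair if $\{e^{-2\pi i\lambda x}:\lambda\in\Lambda\}$ is an orthonormal basis of $L^2(\mu)$. It is known that $(\mu_{b,q\mathcal D},\Lambda(b,\mathcal C))$ is a spectral pair. A real number $t$ is a complete number (of this pair) if $(\mu_{b,q\mathcal D},t\Lambda(b,\mathcal C))$ is also a spectral pair, and an incomplete number otherwise. *)

theory Defs
  imports "HOL-Probability.Probability" "HOL-Number_Theory.Number_Theory"
begin

text \<open>The order \<open>O\<^sub>b(t)\<close> is the library's \<^term>\<open>ord t b\<close> (modulus first).\<close>

definition order_stability :: "nat \<Rightarrow> nat \<Rightarrow> nat" where
  "order_stability b p = (GREATEST k. 0 < k \<and> ord (p ^ k) b = ord p b)"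

definition is_self_similar_measure :: "real \<Rightarrow> real set \<Rightarrow> real measure \<Rightarrow> bool" where
  "is_self_similar_measure \<rho> B M \<longleftrightarrow>
     prob_space M \<and> sets M = sets borel \<and>
     (\<forall>E\<in>sets borel.
        measure M E = (1 / real (card B)) * (\<Sum>a\<in>B. measure M ((\<lambda>x. (x + a) / \<rho>) -` E)))"

text \<open>For \<open>\<rho> > 1\<close> and \<open>B\<close> finite and nonempty, exactly one measure satisfies the predicate
  (Hutchinson), so the description below denotes it.\<close>

definition self_similar_measure :: "real \<Rightarrow> real set \<Rightarrow> real measure" where
  "self_similar_measure \<rho> B = (THE M. is_self_similar_measure \<rho> B M)"

definition radix_expansions :: "real \<Rightarrow> real set \<Rightarrow> real set" where
  "radix_expansions b C = {(\<Sum>k\<le>n. b ^ k * c k) | n c. \<forall>k\<le>n. c k \<in> C}"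

text \<open>Elements of \<open>L\<^sup>2(M)\<close> are represented by functions, not by almost-everywhere classes.\<close>

definition L2_functions :: "'a measure \<Rightarrow> ('a \<Rightarrow> complex) set" where
  "L2_functions M = {f \<in> borel_measurable M. integrable M (\<lambda>x. (cmod (f x))\<^sup>2)}"

definition L2_inner :: "'a measure \<Rightarrow> ('a \<Rightarrow> complex) \<Rightarrow> ('a \<Rightarrow> complex) \<Rightarrow> complex" where
  "L2_inner M f g = (LINT x|M. f x * cnj (g x))"

definition L2_norm :: "'a measure \<Rightarrow> ('a \<Rightarrow> complex) \<Rightarrow> real" where
  "L2_norm M f = sqrt (LINT x|M. (cmod (f x))\<^sup>2)"

text \<open>An orthonormal family whose finite linear combinations are dense in \<open>L\<^sup>2(M)\<close>.\<close>

definition L2_orthonormal_basis ::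
    "'a measure \<Rightarrow> ('i \<Rightarrow> 'a \<Rightarrow> complex) \<Rightarrow> 'i set \<Rightarrow> bool" where
  "L2_orthonormal_basis M e I \<longleftrightarrow>
     (\<forall>i\<in>I. e i \<in> L2_functions M) \<and>
     (\<forall>i\<in>I. \<forall>j\<in>I. L2_inner M (e i) (e j) = (if i = j then 1 else 0)) \<and>
     (\<forall>f\<in>L2_functions M. \<forall>\<epsilon>>0. \<exists>F c. finite F \<and> F \<subseteq> I \<and>
        L2_norm M (\<lambda>x. f x - (\<Sum>i\<in>F. c i * e i x)) < \<epsilon>)"

definition spectral_pair :: "real measure \<Rightarrow> real set \<Rightarrow> bool" where
  "spectral_pair M \<Lambda> \<longleftrightarrow>
     prob_space M \<and> sets M = sets borel \<and> (\<exists>K. compact K \<and> measure M K = 1) \<and>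
     countable \<Lambda> \<and>
     L2_orthonormal_basis M
       (\<lambda>l x. exp (- 2 * complex_of_real pi * \<i> * complex_of_real l * complex_of_real x)) \<Lambda>"

definition complete_number :: "real measure \<Rightarrow> real set \<Rightarrow> real \<Rightarrow> bool" where
  "complete_number M \<Lambda> t \<longleftrightarrow> spectral_pair M ((\<lambda>l. t * l) ` \<Lambda>)"

end

theory Submission
  imports Defs
begin

text \<open>
  Let \<open>h\<close> be the Fourier transform of \<open>\<mu>\<close>. For \<open>t\<close> prime to \<open>b\<close>, the partial sums of
  \<open>\<Sum>|h (\<xi> + \<lambda>)|\<^sup>2\<close> over \<open>\<lambda> \<in> t \<Lambda>\<close> satisfy a recursion whose weights add up to \<open>1\<close>; the sum is
  identically \<open>1\<close>, i.e. \<open>t\<close> is complete, if and only if no sequence of nonzero integers satisfies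
  \<open>b x\<^sub>j\<^sub>+\<^sub>1 = x\<^sub>j + t c\<^sub>j\<close> with digits \<open>c\<^sub>j \<in> \<C>\<close>.

  Suppose \<open>t' = p\<^sub>1\<^sup>k\<^sup>1\<cdots>p\<^sub>m\<^sup>k\<^sup>m\<close> admits such an orbit. All \<open>x\<^sub>j\<close> have the same gcd with \<open>t'\<close>, and
  dividing by it gives an orbit for a divisor \<open>t\<close> of \<open>t'\<close> with \<open>x\<^sub>j\<close> prime to \<open>t\<close>. If the exponent
  of some \<open>p\<^sub>i\<close> in \<open>t\<close> exceeded the threshold \<open>\<ell>\<^sub>b(p\<^sub>i) + l\<^sub>i\<close>, the order of \<open>b\<close> modulo \<open>t\<close> would be
  \<open>p\<^sub>i\<close> times the order modulo \<open>t / p\<^sub>i\<close>, so that the orbit would meet, modulo \<open>t\<close>, points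
  at spacing \<open>t / p\<^sub>i\<close> all around the circle; but eventually \<open>|x\<^sub>j| \<le> 3 t / 8\<close>. Hence \<open>t\<close> divides the
  product of the threshold powers, which then has an orbit too, by scaling.
\<close>

section \<open>The growth of multiplicative orders\<close>

text \<open>The threshold has two sources. \<open>order_stability b (p i)\<close> is the exact
  exponent of \<open>p i\<close> in b^O - 1, where O is the order modulo \<open>p i\<close>; and the
  orders modulo the other primes may already put factors \<open>p i\<close> into the common period,
  at most \<open>l i\<close> of them. Only past both does one more factor \<open>p i\<close> in the
  modulus force one more in the period. The constants belong together. One step gives |x'| <= (|x| +
  t)/4, with fixed point t/3, so every bound above t/3 is reached after finitely many steps. With
  3t/8 a forbidden arc of length at least t/4 remains modulo t, while the spacing t/p is at most
  t/5, because p >= 2N+1 >= 5. On the analytic side the obstacle is that the limit energy is only a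
  supremum of continuous functions; its minimum is found through nested compact sets. Density of all
  exponentials in L2 reduces the basis property to Parseval for single exponentials.\<close>

lemma binomial_expansion_mod_square:
  fixes x :: int
  shows "\<exists>w. (1 + x) ^ n = 1 + int n * x + w * x\<^sup>2"
proof (induction n)
  case (Suc n)
  then obtain w where w: "(1 + x) ^ n = 1 + int n * x + w * x\<^sup>2" by blast
  have "(1 + x) ^ Suc n = 1 + int (Suc n) * x + (int n + w + w * x) * x\<^sup>2"
    by (simp add: w algebra_simps power2_eq_square)
  then show ?case by blast
qed auto

lemma binomial_expansion_mod_cube:
  fixes x :: int
  shows "\<exists>w. (1 + x) ^ n = 1 + int n * x + int (n choose 2) * x\<^sup>2 + w * x ^ 3"
proof (induction n)
  case (Suc n)
  then obtain w where w: "(1 + x) ^ n = 1 + int n * x + int (n choose 2) * x\<^sup>2 + w * x ^ 3"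
    by blast
  have c: "Suc n choose 2 = n + (n choose 2)"
    by (simp add: numeral_2_eq_2)
  have "(1 + x) ^ Suc n = 1 + int (Suc n) * x + int (Suc n choose 2) * x\<^sup>2
          + (int (n choose 2) + w + w * x) * x ^ 3"
    unfolding c by (simp add: w algebra_simps power2_eq_square power3_eq_cube)
  then show ?case by blast
qed (auto simp: numeral_2_eq_2)

text \<open>The expansion has to reach the cube: for odd \<open>p\<close> the quadratic term is
  divisible by p^(2k+1) and the cubic one by p^(3k), both multiples of p^(k+2) since k >= 1, so the
  linear term alone decides the exact exponent.\<close>

lemma power_prime_lift_exact:
  fixes a u :: int and p :: nat
  assumes "prime p" "p \<noteq> 2" "k \<ge> 1" "a = 1 + int p ^ k * u" "\<not> int p dvd u"
  shows "\<exists>v. \<not> int p dvd v \<and> a ^ p = 1 + int p ^ Suc k * v"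
proof -
  define x where "x = int p ^ k * u"
  obtain w where w: "(1 + x) ^ p = 1 + int p * x + int (p choose 2) * x\<^sup>2 + w * x ^ 3"
    using binomial_expansion_mod_cube by blast
  have "2 < p" using assms(1,2) prime_ge_2_nat[of p] by linarith
  then have "p dvd p choose 2" using assms(1) by (intro dvd_choose_prime) auto
  then obtain z where z: "p choose 2 = p * z" by blast
  obtain k' where k: "k = Suc k'" using assms(3) by (cases k) auto
  define v where "v = u + int p * (int p ^ k' * int z * u\<^sup>2 + w * int p ^ (2 * k') * u ^ 3)"
  have "1 + int p * x + int (p choose 2) * x\<^sup>2 + w * x ^ 3 = 1 + int p ^ Suc k * v"
    unfolding v_def x_def z k
    by (simp add: algebra_simps power2_eq_square power3_eq_cube power_add mult_2_right)
  then have "(1 + x) ^ p = 1 + int p ^ Suc k * v" using w by simp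
  moreover have "\<not> int p dvd v"
    using assms(5) unfolding v_def by (simp add: dvd_add_left_iff)
  ultimately show ?thesis using assms(4) x_def by blast
qed

lemma power_coprime_lift_exact:
  fixes a u :: int and p :: nat
  assumes "prime p" "k \<ge> 1" "a = 1 + int p ^ k * u" "\<not> int p dvd u" "\<not> p dvd s"
  shows "\<exists>v. \<not> int p dvd v \<and> a ^ s = 1 + int p ^ k * v"
proof -
  define x where "x = int p ^ k * u"
  obtain w where w: "(1 + x) ^ s = 1 + int s * x + w * x\<^sup>2"
    using binomial_expansion_mod_square by blast
  obtain k' where k: "k = Suc k'" using assms(2) by (cases k) auto
  define v where "v = int s * u + int p * (int p ^ k' * w * u\<^sup>2)"
  have "1 + int s * x + w * x\<^sup>2 = 1 + int p ^ k * v"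
    unfolding v_def x_def k by (simp add: algebra_simps power2_eq_square)
  then have "(1 + x) ^ s = 1 + int p ^ k * v" using w by simp
  moreover have "\<not> int p dvd int s * u"
    using assms(1,4,5) by (simp add: prime_dvd_mult_iff)
  then have "\<not> int p dvd v"
    unfolding v_def by (simp add: dvd_add_left_iff)
  ultimately show ?thesis using assms(3) x_def by blast
qed

text \<open>Each \<open>p\<close>-th power raises the exponent of \<open>p\<close> in
  \<open>a - 1\<close> by exactly one, and a power prime to \<open>p\<close> leaves it
  unchanged.\<close>

lemma lifting_the_exponent:
  fixes a u :: int and p :: nat
  assumes p: "prime p" "p \<noteq> 2" and k: "k \<ge> 1"
    and a: "a = 1 + int p ^ k * u" "\<not> int p dvd u" and s: "\<not> p dvd s"
  shows "\<exists>v. \<not> int p dvd v \<and> a ^ (p ^ i * s) = 1 + int p ^ (k + i) * v"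
proof -
  have "\<exists>v. \<not> int p dvd v \<and> a ^ (p ^ i) = 1 + int p ^ (k + i) * v"
  proof (induction i)
    case (Suc i)
    then obtain v where v: "\<not> int p dvd v" "a ^ (p ^ i) = 1 + int p ^ (k + i) * v" by blast
    have "\<exists>v'. \<not> int p dvd v' \<and> (a ^ (p ^ i)) ^ p = 1 + int p ^ Suc (k + i) * v'"
      using k by (intro power_prime_lift_exact[OF p _ v(2,1)]) auto
    then show ?case by (simp add: power_mult[symmetric] mult.commute)
  qed (use a in auto)
  then obtain v where v: "\<not> int p dvd v" "a ^ (p ^ i) = 1 + int p ^ (k + i) * v" by blast
  have "\<exists>v'. \<not> int p dvd v' \<and> (a ^ (p ^ i)) ^ s = 1 + int p ^ (k + i) * v'"
    using k by (intro power_coprime_lift_exact[OF p(1) _ v(2,1) s]) auto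
  then show ?thesis by (simp add: power_mult)
qed

text \<open>Each further power gains a factor \<open>p\<close>, as the quadratic remainder is
  divisible by p^(2i+2). Serves the primes of the modulus for which divisibility suffices and no
  exact exponent is asked.\<close>

lemma power_prime_power_lift_dvd:
  fixes a :: int and p :: nat
  assumes "int p dvd a - 1"
  shows "int p ^ Suc i dvd a ^ (p ^ i) - 1"
proof (induction i)
  case (Suc i)
  then obtain y where y: "a ^ (p ^ i) - 1 = int p ^ Suc i * y" by blast
  define x where "x = int p ^ Suc i * y"
  obtain w where w: "(1 + x) ^ p = 1 + int p * x + w * x\<^sup>2"
    using binomial_expansion_mod_square by blast
  have "1 + x = a ^ (p ^ i)" using y by (simp add: x_def)
  then have "a ^ (p ^ Suc i) = (1 + x) ^ p"
    by (simp add: power_mult[symmetric] mult.commute)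
  moreover have "1 + int p * x + w * x\<^sup>2 - 1 = int p ^ Suc (Suc i) * (y + w * int p ^ i * y\<^sup>2)"
    by (simp add: x_def algebra_simps power2_eq_square)
  ultimately have "a ^ (p ^ Suc i) - 1 = int p ^ Suc (Suc i) * (y + w * int p ^ i * y\<^sup>2)"
    using w by simp
  then show ?case by simp
qed (use assms in auto)

text \<open>The order modulo p^k equals \<open>ord p b\<close> exactly when p^k divides b^(ord p b)
  - 1, so the largest such k is the \<open>p\<close>-adic valuation of that number, the starting
  value for lifting the exponent.\<close>

lemma order_stability_exact:
  fixes b p :: nat
  assumes p: "prime p" "coprime p b" and b: "b \<ge> 2"
  shows "order_stability b p \<ge> 1"
    and "\<exists>u. \<not> int p dvd u \<and> int b ^ ord p b = 1 + int p ^ order_stability b p * u"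
proof -
  define O' where "O' = ord p b"
  have O: "O' > 0" using p(2) by (simp add: O'_def)
  have stable_iff: "ord (p ^ k) b = O' \<longleftrightarrow> int p ^ k dvd int b ^ O' - 1" if "k > 0" for k
  proof
    assume "ord (p ^ k) b = O'"
    then have "[b ^ O' = 1] (mod p ^ k)" using ord[of b "p ^ k"] by simp
    then have "[int (b ^ O') = int 1] (mod int (p ^ k))" by (simp only: cong_int_iff)
    then show "int p ^ k dvd int b ^ O' - 1" by (simp add: cong_iff_dvd_diff)
  next
    assume "int p ^ k dvd int b ^ O' - 1"
    then have "[int (b ^ O') = int 1] (mod int (p ^ k))" by (simp add: cong_iff_dvd_diff)
    then have "[b ^ O' = 1] (mod p ^ k)" by (simp only: cong_int_iff)
    then have 1: "ord (p ^ k) b dvd O'" by (simp only: ord_divides)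
    have "[b ^ ord (p ^ k) b = 1] (mod p ^ k)" by (rule ord)
    then have "[b ^ ord (p ^ k) b = 1] (mod p)"
      by (rule cong_dvd_modulus_nat) (use that in \<open>simp add: dvd_power\<close>)
    then have "O' dvd ord (p ^ k) b" unfolding O'_def by (simp only: ord_divides)
    then show "ord (p ^ k) b = O'" using 1 by (simp add: dvd_antisym)
  qed
  \<comment> \<open>Positivity bounds the admissible k; \<open>GREATEST\<close> has its meaning only
    under such a bound.\<close>
  have pos: "int b ^ O' - 1 > 0"
    using b O by (simp add: one_less_power)
  have bound: "k \<le> b ^ O'" if "0 < k \<and> ord (p ^ k) b = ord p b" for k
  proof -
    have "int p ^ k dvd int b ^ O' - 1" using stable_iff that O'_def by blast
    then have "int p ^ k \<le> int b ^ O' - 1" using pos by (rule zdvd_imp_le)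
    then have "int (p ^ k) \<le> int (b ^ O')" by simp
    then have "p ^ k \<le> b ^ O'" by (simp only: of_nat_le_iff)
    moreover have "k < p ^ k" using prime_gt_1_nat[OF p(1)] by (intro power_gt_expt) simp
    ultimately show ?thesis by linarith
  qed
  have one: "0 < (1::nat) \<and> ord (p ^ 1) b = ord p b" by simp
  have gr: "0 < order_stability b p \<and> ord (p ^ order_stability b p) b = ord p b"
    unfolding order_stability_def
    using GreatestI_nat[where P="\<lambda>k. 0 < k \<and> ord (p ^ k) b = ord p b" and b="b ^ O'", OF one] bound by blast
  then show "order_stability b p \<ge> 1" by simp
  have "int p ^ order_stability b p dvd int b ^ O' - 1"
    using gr stable_iff O'_def by blast
  then obtain u where u: "int b ^ O' - 1 = int p ^ order_stability b p * u" by blast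
  have "\<not> int p dvd u"
  proof
    assume "int p dvd u"
    then have "int p ^ Suc (order_stability b p) dvd int b ^ O' - 1"
      unfolding u by (auto simp: mult.assoc)
    then have "0 < Suc (order_stability b p) \<and> ord (p ^ Suc (order_stability b p)) b = ord p b"
      using stable_iff O'_def by blast
    then have "Suc (order_stability b p) \<le> order_stability b p"
      unfolding order_stability_def
      by (rule Greatest_le_nat[where P="\<lambda>k. 0 < k \<and> ord (p ^ k) b = ord p b" and b="b ^ O'"]) (use bound in blast)
    then show False by simp
  qed
  then show "\<exists>u. \<not> int p dvd u \<and> int b ^ ord p b = 1 + int p ^ order_stability b p * u"
    using u O'_def by (intro exI[of _ u]) (auto simp: algebra_simps)
qed

lemma prod_dvd_of_pairwise_coprime:
  fixes f :: "'i \<Rightarrow> int"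
  assumes "finite A" "\<And>i. i \<in> A \<Longrightarrow> f i dvd c"
    "\<And>i j. i \<in> A \<Longrightarrow> j \<in> A \<Longrightarrow> i \<noteq> j \<Longrightarrow> coprime (f i) (f j)"
  shows "(\<Prod>i\<in>A. f i) dvd c"
  using assms
proof (induction A rule: finite_induct)
  case (insert a A)
  have "coprime (f a) (\<Prod>i\<in>A. f i)"
    using insert.prems(2) insert.hyps(2) by (intro prod_coprime_right) blast
  then have "f a * (\<Prod>i\<in>A. f i) dvd c"
    using insert.IH insert.prems by (intro divides_mult) blast+
  then show ?case using insert.hyps by simp
qed auto

text \<open>Once the exponent of \<open>p i\<close> exceeds the threshold, lowering it by one divides the order by
  \<open>p i\<close>; \<open>r\<close> is a multiple of the smaller order but not of the larger one.\<close>

lemma order_grows_beyond_threshold: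
  fixes b :: nat and p e :: "'i \<Rightarrow> nat"
  assumes fin: "finite I" and inj: "inj_on p I" and b: "b \<ge> 2"
    and pr: "\<And>j. j \<in> I \<Longrightarrow> prime (p j)" "\<And>j. j \<in> I \<Longrightarrow> coprime (p j) b"
    and i: "i \<in> I" "p i \<noteq> 2"
    and big: "e i > order_stability b (p i) + multiplicity (p i) (LCM j\<in>I. ord (p j) b)"
  shows "\<exists>T r u. int (p i) * T = int (\<Prod>j\<in>I. p j ^ e j) \<and> int (p i) dvd T
           \<and> int b ^ r = 1 + u * T \<and> \<not> int (p i) dvd u"
proof -
  define q where "q = p i"
  define L where "L = (LCM j\<in>I. ord (p j) b)"
  define c where "c = multiplicity q L"
  define s where "s = order_stability b q"
  have q: "prime q" "coprime q b" "q \<noteq> 2" using pr i by (auto simp: q_def)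
  have s: "s \<ge> 1" using order_stability_exact[OF q(1,2) b] by (simp add: s_def)
  obtain u0 where u0: "\<not> int q dvd u0" "int b ^ ord q b = 1 + int q ^ s * u0"
    using order_stability_exact(2)[OF q(1,2) b] by (auto simp: s_def)
  have ord0: "ord (p j) b \<noteq> 0" if "j \<in> I" for j
    using pr(2)[OF that] ord_eq_0[of "p j" b] by blast
  have "0 \<notin> (\<lambda>j. ord (p j) b) ` I"
  proof
    assume "0 \<in> (\<lambda>j. ord (p j) b) ` I"
    then obtain j where "j \<in> I" "0 = ord (p j) b" by (rule imageE)
    then show False using ord0[of j] by argo
  qed
  then have L0: "L \<noteq> 0"
    unfolding L_def using fin by (simp add: Lcm_0_iff)
  have ordL: "ord (p j) b dvd L" if "j \<in> I" for j
    unfolding L_def using that by (intro dvd_Lcm imageI)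
  obtain L' where L': "L = q ^ c * L'" "\<not> q dvd L'"
    unfolding c_def using L0 q(1) not_prime_unit by (rule_tac multiplicity_decompose'[of L q]) blast+
  define R where "R = (\<Prod>j\<in>I - {i}. p j ^ e j)"
  have qR: "\<not> q dvd R"
  proof
    assume "q dvd R"
    then obtain j where j: "j \<in> I - {i}" "q dvd p j ^ e j"
      unfolding R_def using prime_dvd_prod_iff[of "I - {i}" q "\<lambda>j. p j ^ e j"] q(1) fin by auto
    then have "q dvd p j" using q(1) prime_dvd_power by blast
    then have "p i = p j" using j pr(1) i by (simp add: q_def primes_dvd_imp_eq)
    then show False using inj j i by (auto dest: inj_onD)
  qed
  \<comment> \<open>The surplus over the threshold, less one: \<open>T\<close> will have
    \<open>q\<close>-exponent s + c + d = e i - 1.\<close>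
  define d where "d = e i - 1 - s - c"
  have "e i > s + c" using big unfolding s_def c_def q_def L_def .
  then have ei: "e i = Suc (s + c + d)" unfolding d_def by linarith
  \<comment> \<open>\<open>L\<close> is a period modulo every prime, \<open>R\<close> lifts it to
    the other prime powers, and \<open>L * q ^ d\<close> gives \<open>r\<close> the exact
    \<open>q\<close>-exponent c + d, so that b^r - 1 has exact \<open>q\<close>-exponent s + c +
    d.\<close>
  define r where "r = L * q ^ d * R"
  \<comment> \<open>The order divides q - 1, so it is prime to \<open>q\<close> and must divide the
    \<open>q\<close>-free part \<open>L' * R\<close> of \<open>r\<close>; the quotient becomes the
    exponent prime to \<open>q\<close> in the lifting.\<close>
  have qord: "\<not> q dvd ord q b"
  proof
    assume "q dvd ord q b"
    also have "ord q b dvd totient q" using q(2) by (intro order_divides_totient)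
    also have "totient q = q - 1" using q(1) by (rule totient_prime)
    finally have "q \<le> q - 1"
      using prime_gt_1_nat[OF q(1)] by (intro dvd_imp_le) auto
    then show False using prime_gt_0_nat[OF q(1)] by simp
  qed
  have "q ^ (c + d) * (L' * R) = r"
    unfolding r_def L'(1) by (simp add: power_add algebra_simps)
  moreover have "ord q b dvd r" unfolding r_def using ordL[OF i(1)] by (simp add: q_def)
  ultimately have "ord q b dvd q ^ (c + d) * (L' * R)" by simp
  moreover have "coprime (ord q b) (q ^ (c + d))"
    using prime_imp_coprime[OF q(1) qord] coprime_commute coprime_power_right_iff by blast
  ultimately have "ord q b dvd L' * R" by (simp add: coprime_dvd_mult_right_iff)
  then obtain s' where s': "L' * R = ord q b * s'" by blast
  have "\<not> q dvd s'"
    using s' L'(2) qR q(1) prime_dvd_mult_iff[of q L' R] dvd_mult[of q s' "ord q b"] by auto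
  then obtain v where v: "\<not> int q dvd v"
      "(int b ^ ord q b) ^ (q ^ (c + d) * s') = 1 + int q ^ (s + (c + d)) * v"
    using lifting_the_exponent[OF q(1,3) s u0(2,1)] by blast
  have r_eq: "r = ord q b * (q ^ (c + d) * s')"
    using \<open>q ^ (c + d) * (L' * R) = r\<close> unfolding s' by (simp add: algebra_simps)
  have br: "int b ^ r = 1 + int q ^ (s + c + d) * v"
    using v(2) unfolding r_eq by (simp add: power_mult add.assoc)
  define T where "T = int q ^ (s + c + d) * int R"
  have other: "int (p j) ^ e j dvd int b ^ r - 1" if j: "j \<in> I - {i}" for j
  proof -
    have "ord (p j) b dvd L" using ordL j by simp
    then have "[b ^ L = 1] (mod p j)" by (simp only: ord_divides)
    then have "[int (b ^ L) = int 1] (mod int (p j))" by (simp only: cong_int_iff)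
    then have "int (p j) dvd int b ^ L - 1" by (simp add: cong_iff_dvd_diff)
    then have 1: "int (p j) ^ Suc (e j) dvd (int b ^ L) ^ (p j ^ e j) - 1"
      by (rule power_prime_power_lift_dvd)
    have "p j ^ e j dvd R" unfolding R_def using fin j by (intro dvd_prodI) auto
    then obtain z where z: "R = p j ^ e j * z" by blast
    have "int b ^ r = ((int b ^ L) ^ (p j ^ e j)) ^ (q ^ d * z)"
      unfolding r_def z by (simp add: power_mult[symmetric] algebra_simps)
    moreover have "(y::int) - 1 dvd y ^ n - 1" for y n
      using power_diff_1_eq[of y n] by (cases "n = 0") auto
    ultimately have "(int b ^ L) ^ (p j ^ e j) - 1 dvd int b ^ r - 1" by simp
    moreover have "int (p j) ^ e j dvd int (p j) ^ Suc (e j)" by simp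
    ultimately show ?thesis using 1 by (meson dvd_trans)
  qed
  have "int R dvd int b ^ r - 1"
  proof -
    have "(\<Prod>j\<in>I - {i}. int (p j) ^ e j) dvd int b ^ r - 1"
    proof (rule prod_dvd_of_pairwise_coprime)
      show "finite (I - {i})" using fin by simp
      show "int (p j) ^ e j dvd int b ^ r - 1" if "j \<in> I - {i}" for j using other that .
      fix j k assume jk: "j \<in> I - {i}" "k \<in> I - {i}" "j \<noteq> k"
      then have "p j \<noteq> p k" using inj by (auto dest: inj_onD)
      then have "coprime (p j) (p k)" using jk pr(1) by (auto intro: primes_coprime)
      then show "coprime (int (p j) ^ e j) (int (p k) ^ e k)" by simp
    qed
    then show ?thesis by (simp add: R_def)
  qed
  moreover have "coprime R q"
    using prime_imp_coprime[OF q(1) qR] coprime_commute by blast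
  then have "coprime (int R) (int q ^ (s + c + d))" by simp
  moreover have "int q ^ (s + c + d) dvd int b ^ r - 1" using br by simp
  ultimately have "T dvd int b ^ r - 1"
    unfolding T_def by (subst mult.commute) (rule divides_mult)
  then obtain u where u: "int b ^ r - 1 = T * u" by blast
  have q0: "int q ^ (s + c + d) \<noteq> 0" using q(1) by (auto simp: prime_gt_0_nat)
  have "int q ^ (s + c + d) * v = int q ^ (s + c + d) * (int R * u)"
    using u br unfolding T_def by (simp add: mult.assoc)
  then have "v = int R * u" using mult_left_cancel[OF q0] by blast
  then have "\<not> int q dvd u" using v(1) by auto
  moreover have "int b ^ r = 1 + u * T" using u by (simp add: algebra_simps)
  moreover have "int q dvd T" unfolding T_def using s by (cases s) auto
  moreover have "int q * T = int (\<Prod>j\<in>I. p j ^ e j)"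
    using fin i(1) by (simp add: prod.remove[of I i] R_def T_def q_def ei)
  ultimately show ?thesis unfolding q_def by blast
qed

section \<open>Digit orbits\<close>

text \<open>Doubling the inequalities expresses the interval (-N/2, N/2] within the
  integers.\<close>

definition centered_digits :: "nat \<Rightarrow> int set" where
  "centered_digits N = {c. - int N < 2 * c \<and> 2 * c \<le> int N}"

text \<open>These orbits of the maps \<open>y \<mapsto> (y + t c) / b\<close> replace the nontrivial extreme cycles of the
  literature; periodicity is never needed.\<close>

definition digit_orbit :: "nat \<Rightarrow> nat \<Rightarrow> nat \<Rightarrow> (nat \<Rightarrow> int) \<Rightarrow> bool" where
  "digit_orbit N b t x \<longleftrightarrow>
     (\<forall>j. x j \<noteq> 0 \<and> (\<exists>c\<in>centered_digits N. int b * x (Suc j) = x j + int t * c))"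

text \<open>From |c| <= N/2 and b >= 2N >= 4: |x'| <= |x|/b + tN/(2b) <= |x|/4 + t/4.\<close>

lemma digit_orbit_step:
  assumes "digit_orbit N b t x" "N \<ge> 2" "b \<ge> 2 * N"
  shows "4 * \<bar>x (Suc j)\<bar> \<le> \<bar>x j\<bar> + int t"
proof -
  obtain c where c: "- int N < 2 * c" "2 * c \<le> int N" "int b * x (Suc j) = x j + int t * c"
    using assms(1) unfolding digit_orbit_def centered_digits_def by blast
  have "2 * \<bar>int t * c\<bar> = int t * \<bar>2 * c\<bar>" by (simp add: abs_mult)
  also have "\<dots> \<le> int t * int N" using c by (intro mult_left_mono) auto
  finally have tc: "2 * \<bar>int t * c\<bar> \<le> int t * int N" .
  have "int b * \<bar>x (Suc j)\<bar> = \<bar>x j + int t * c\<bar>" using c(3) by (metis abs_mult abs_of_nat)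
  also have "\<dots> \<le> \<bar>x j\<bar> + \<bar>int t * c\<bar>" by (rule abs_triangle_ineq)
  finally have 1: "2 * (int b * \<bar>x (Suc j)\<bar>) \<le> 2 * \<bar>x j\<bar> + int t * int N" using tc by linarith
  have "2 * int N * \<bar>x (Suc j)\<bar> \<le> int b * \<bar>x (Suc j)\<bar>"
    using assms(3) by (intro mult_right_mono) auto
  then have "4 * (int N * \<bar>x (Suc j)\<bar>) \<le> 2 * \<bar>x j\<bar> + int t * int N" using 1 by linarith
  moreover have "2 * \<bar>x j\<bar> \<le> int N * \<bar>x j\<bar>" using assms(2) by (intro mult_right_mono) auto
  ultimately have "int N * (4 * \<bar>x (Suc j)\<bar>) \<le> int N * (\<bar>x j\<bar> + int t)"
    by (simp add: algebra_simps)
  then show ?thesis using assms(2) by simp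
qed

text \<open>Above 3t/8 a step strictly lowers the natural number |x j|, since 3/8 exceeds the fixed
  point 1/3 of the contraction; at or below 3t/8 the bound persists because (3/8 + 1)/4 <
  3/8.\<close>

lemma digit_orbit_eventually_small:
  assumes "digit_orbit N b t x" "N \<ge> 2" "b \<ge> 2 * N"
  obtains J where "\<And>j. j \<ge> J \<Longrightarrow> 8 * \<bar>x j\<bar> \<le> 3 * int t"
proof -
  note step = digit_orbit_step[OF assms]
  have "\<exists>J. 8 * \<bar>x J\<bar> \<le> 3 * int t" if "nat \<bar>x j\<bar> = n" for n j
    using that
  proof (induction n arbitrary: j rule: less_induct)
    case (less n)
    show ?case
    proof (cases "8 * \<bar>x j\<bar> \<le> 3 * int t")
      case False
      then have "nat \<bar>x (Suc j)\<bar> < n" using step[of j] less.prems by linarith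
      then show ?thesis using less.IH by blast
    qed auto
  qed
  then obtain J where J: "8 * \<bar>x J\<bar> \<le> 3 * int t" by blast
  have "8 * \<bar>x j\<bar> \<le> 3 * int t" if "j \<ge> J" for j
    using that
  proof (induction j rule: dec_induct)
    case (step j)
    then show ?case using \<open>4 * \<bar>x (Suc j)\<bar> \<le> \<bar>x j\<bar> + int t\<close> by linarith
  qed (rule J)
  then show ?thesis using that by blast
qed

text \<open>Moving \<open>r\<close> steps along the orbit multiplies by the inverse of b^r, which is
  1 - u T modulo \<open>t\<close>. Hence s * r steps shift \<open>x J\<close> by - s u T x J, and as
  \<open>p\<close> does not divide u * x J these shifts run through all multiples of
  \<open>T\<close> modulo \<open>t\<close>.\<close>

lemma orbit_equidistributed:
  fixes x :: "nat \<Rightarrow> int" and b p t T u :: int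
  assumes p: "prime p" "p * T = t" "p dvd T"
    and x: "\<And>j. [x j = b * x (Suc j)] (mod t)" "\<not> p dvd x 0"
    and r: "b ^ r = 1 + u * T" "\<not> p dvd u"
  shows "\<exists>j\<ge>J. [x j = x J + k * T] (mod t)"
proof -
  have pw: "[x j = b ^ n * x (j + n)] (mod t)" for j n
  proof (induction n)
    case (Suc n)
    have "[b ^ n * x (j + n) = b ^ n * (b * x (Suc (j + n)))] (mod t)"
      using x(1) by (rule cong_scalar_left)
    then have "[x j = b ^ n * (b * x (Suc (j + n)))] (mod t)" using Suc cong_trans by blast
    then show ?case by (simp add: ac_simps)
  qed auto
  have pt: "p dvd t" using p(2) by auto
  have ndvd: "\<not> p dvd x j" for j
  proof
    assume "p dvd x j"
    moreover have "[x 0 = b ^ j * x j] (mod p)"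
      using pw[of 0 j] pt by (auto intro: cong_dvd_modulus)
    ultimately have "p dvd x 0" by (simp add: cong_dvd_iff)
    then show False using x(2) by simp
  qed
  have shift: "[x (j + r) = x j - u * T * x j] (mod t)" for j
  proof -
    define y where "y = x (j + r)"
    obtain w where w: "x j - b ^ r * y = t * w"
      using pw[of j r] unfolding y_def by (auto simp: cong_iff_dvd_diff)
    \<comment> \<open>T * T = t * S, so terms quadratic in \<open>T\<close> vanish modulo
      \<open>t\<close>; this is what makes 1 - u T an inverse of b^r.\<close>
    obtain S where S: "T = p * S" using p(3) by blast
    have xj: "x j = t * w + (1 + u * T) * y" using w r(1) by (simp add: algebra_simps)
    have "y - (x j - u * T * x j) = t * (u * S * u * y + u * T * w - w)"
      unfolding xj unfolding p(2)[symmetric] unfolding S by (simp add: algebra_simps)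
    then have "t dvd y - (x j - u * T * x j)" by simp
    then show ?thesis by (simp add: y_def cong_iff_dvd_diff)
  qed
  have multi: "[x (J + s * r) = x J - int s * u * T * x J] (mod t)" for s
  proof (induction s)
    case (Suc s)
    obtain S where S: "T = p * S" using p(3) by blast
    define y where "y = x (J + s * r)"
    obtain w where w: "y - (x J - int s * u * T * x J) = t * w"
      using Suc unfolding y_def by (auto simp: cong_iff_dvd_diff)
    have y: "y = x J - int s * u * T * x J + t * w" using w by simp
    have 1: "[x (J + s * r + r) = y - u * T * y] (mod t)" using shift unfolding y_def .
    have "y - u * T * y - (x J - int (Suc s) * u * T * x J)
        = t * (u * S * int s * u * x J + w - u * T * w)"
      unfolding y unfolding p(2)[symmetric] unfolding S by (simp add: algebra_simps)
    then have "t dvd y - u * T * y - (x J - int (Suc s) * u * T * x J)" by simp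
    then have "[y - u * T * y = x J - int (Suc s) * u * T * x J] (mod t)"
      by (simp add: cong_iff_dvd_diff)
    then have "[x (J + s * r + r) = x J - int (Suc s) * u * T * x J] (mod t)"
      using 1 cong_trans by blast
    then show ?case by (simp add: ac_simps)
  qed auto
  have "\<not> p dvd u * x J" using p(1) r(2) ndvd by (simp add: prime_dvd_mult_iff)
  then have "coprime p (u * x J)" using p(1) prime_imp_coprime by blast
  then have "coprime (u * x J) p" by (rule coprime_commute[THEN iffD1])
  then obtain v where v: "[u * x J * v = 1] (mod p)" using cong_solve_coprime_int by blast
  \<comment> \<open>Solves - s * u * x J = k modulo \<open>p\<close>; taking the residue makes s a
    natural number, so the index J + s * r is at least \<open>J\<close>.\<close>
  define s where "s = nat ((- k * v) mod p)"
  have p0: "p > 0" using p(1) by (simp add: prime_gt_0_int)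
  have s: "int s = (- k * v) mod p" using p0 by (simp add: s_def)
  then have "[int s = - k * v] (mod p)" by simp
  then have "[- (u * x J * int s) = - (u * x J * (- k * v))] (mod p)"
    by (intro cong_scalar_left cong_minus_minus_iff[THEN iffD2])
  also have "- (u * x J * (- k * v)) = k * (u * x J * v)" by simp
  also have "[k * (u * x J * v) = k * 1] (mod p)" using v by (rule cong_scalar_left)
  finally obtain w where w: "- (u * x J * int s) - k = p * w" by (auto simp: cong_iff_dvd_diff)
  have "x J - int s * u * T * x J - (x J + k * T) = (- (u * x J * int s) - k) * T"
    by (simp add: algebra_simps)
  also have "\<dots> = t * w" unfolding w using p(2) by (simp add: ac_simps)
  finally have "x J - int s * u * T * x J - (x J + k * T) = t * w" .
  then have "[x J - int s * u * T * x J = x J + k * T] (mod t)" by (simp add: cong_iff_dvd_diff)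
  then have "[x (J + s * r) = x J + k * T] (mod t)" using multi cong_trans by blast
  then show ?thesis by (intro exI[of _ "J + s * r"]) auto
qed

text \<open>Late orbit points lie in [-\<beta>, \<beta>], so modulo \<open>t\<close> they avoid
  \<beta> + 1, ..., t - \<beta> - 1. This gap holds \<open>T\<close> consecutive integers, since 2
  \<beta> + T <= 3t/4 + t/5 < t, and so it meets the class of \<open>x J\<close> modulo
  \<open>T\<close>; equidistribution sends a late point there.\<close>

lemma digit_orbit_no_large_order:
  fixes T u :: int
  assumes orb: "digit_orbit N b t x" and N: "N \<ge> 2" "b \<ge> 2 * N"
    and p: "prime p" "p \<ge> 5" "int p * T = int t" "int p dvd T" "\<not> int p dvd x 0"
    and r: "int b ^ r = 1 + u * T" "\<not> int p dvd u" and t: "t > 0"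
  shows False
proof -
  obtain J where J: "\<And>j. j \<ge> J \<Longrightarrow> 8 * \<bar>x j\<bar> \<le> 3 * int t"
    using digit_orbit_eventually_small[OF orb N] by blast
  define \<beta> where "\<beta> = (3 * int t) div 8"
  have T0: "T > 0" using p(1,3) t by (metis of_nat_0_less_iff prime_gt_0_nat zero_less_mult_pos)
  have "5 * T \<le> int p * T" using p(2) T0 by (intro mult_right_mono) auto
  then have T5: "5 * T \<le> int t" using p(3) by simp
  \<comment> \<open>The representative of \<open>x J\<close> modulo \<open>T\<close> among the
    \<open>T\<close> integers directly above the window.\<close>
  define y where "y = \<beta> + 1 + (x J - \<beta> - 1) mod T"
  have y: "\<beta> + 1 \<le> y" "y \<le> \<beta> + T" using pos_mod_bound[OF T0, of "x J - \<beta> - 1"] pos_mod_sign[OF T0, of "x J - \<beta> - 1"]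
    unfolding y_def by linarith+
  have "y = x J + (- ((x J - \<beta> - 1) div T)) * T"
    unfolding y_def by (simp add: minus_div_mult_eq_mod[symmetric])
  then obtain k where k: "y = x J + k * T" by blast
  have "[x j = int b * x (Suc j)] (mod int t)" for j
  proof -
    obtain c where "int b * x (Suc j) = x j + int t * c"
      using orb unfolding digit_orbit_def by blast
    then show ?thesis by (simp add: cong_iff_dvd_diff)
  qed
  then obtain j where j: "j \<ge> J" "[x j = y] (mod int t)"
    unfolding k using orbit_equidistributed[of "int p" T "int t" x "int b" r u J k] p r by auto
  then obtain z where z: "x j - y = int t * z" by (auto simp: cong_iff_dvd_diff)
  have xj: "\<bar>x j\<bar> \<le> \<beta>" unfolding \<beta>_def using J[OF j(1)] by linarith
  have \<beta>: "8 * \<beta> \<le> 3 * int t" unfolding \<beta>_def by simp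
  show False
  \<comment> \<open>In x j = y + t * z, z >= 0 puts the point above \<beta>, and z < 0 puts it at
    most at \<beta> + T - t < - \<beta>.\<close>
  proof (cases "z \<ge> 0")
    case True
    then have "int t * z \<ge> 0" by simp
    then show False using z y xj by linarith
  next
    case False
    then have "int t * z \<le> int t * (- 1)" by (intro mult_left_mono) auto
    then show False using z y xj \<beta> T5 t by linarith
  qed
qed

section \<open>Reduction of an orbit to the threshold exponents\<close>

lemma digit_orbit_scale:
  assumes "digit_orbit N b t x" "s > 0"
  shows "digit_orbit N b (s * t) (\<lambda>j. int s * x j)"
  unfolding digit_orbit_def
proof (intro allI conjI)
  fix j
  obtain c where c: "c \<in> centered_digits N" "int b * x (Suc j) = x j + int t * c"
    using assms(1) unfolding digit_orbit_def by blast
  have "int b * (int s * x (Suc j)) = int s * (int b * x (Suc j))" by simp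
  also have "\<dots> = int s * x j + int (s * t) * c" unfolding c(2) by (simp add: algebra_simps)
  finally show "\<exists>c\<in>centered_digits N. int b * (int s * x (Suc j)) = int s * x j + int (s * t) * c"
    using c(1) by blast
  show "int s * x j \<noteq> 0" using assms unfolding digit_orbit_def by auto
qed

text \<open>\<open>b\<close> is invertible modulo \<open>t\<close>, hence the gcd with
  \<open>t\<close> is constant along the orbit and one division clears it from all equations. The
  coprimality gained is the starting condition of the equidistribution argument.\<close>

lemma digit_orbit_cancel_gcd:
  assumes orb: "digit_orbit N b t x" and cop: "coprime b t" and t: "t > 0"
  obtains t' x' where "t' dvd t" "digit_orbit N b t' x'" "coprime (x' 0) (int t')"
proof -
  define g where "g = gcd (int t) (x 0)"
  have g: "gcd (int t) (x j) = g" for j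
  proof (induction j)
    case (Suc j)
    obtain c where c: "int b * x (Suc j) = x j + int t * c"
      using orb unfolding digit_orbit_def by blast
    have "coprime (int t) (int b)" using cop by (simp add: coprime_commute)
    then have "gcd (int t) (x (Suc j)) = gcd (int t) (int b * x (Suc j))"
      by (rule gcd_mult_right_left_cancel[symmetric])
    also have "\<dots> = gcd (int t) (x j + int t * c)" using c by simp
    also have "\<dots> = gcd (int t) (x j)" using gcd_add_mult[of "int t" c "x j"] by (simp add: ac_simps)
    finally show ?case using Suc by simp
  qed (simp add: g_def)
  have g0: "g > 0" using t by (simp add: g_def)
  define t' where "t' = nat (int t div g)"
  have t': "int t = g * int t'"
  proof -
    have "g dvd int t" by (simp add: g_def)
    moreover have "int t div g \<ge> 0" using g0 by (simp add: pos_imp_zdiv_nonneg_iff)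
    ultimately show ?thesis unfolding t'_def by simp
  qed
  define x' where "x' j = x j div g" for j
  have x': "x j = g * x' j" for j
  proof -
    have "g dvd x j" using g[of j] gcd_dvd2[of "int t" "x j"] by simp
    then show ?thesis unfolding x'_def by simp
  qed
  have "digit_orbit N b t' x'"
    unfolding digit_orbit_def
  proof (intro allI conjI)
    fix j
    obtain c where c: "c \<in> centered_digits N" "int b * x (Suc j) = x j + int t * c"
      using orb unfolding digit_orbit_def by blast
    have "g * (int b * x' (Suc j)) = g * (x' j + int t' * c)"
      using c(2) unfolding x' t' by (simp add: algebra_simps)
    then show "\<exists>c\<in>centered_digits N. int b * x' (Suc j) = x' j + int t' * c" using c(1) g0 by auto
    show "x' j \<noteq> 0" using orb x'[of j] unfolding digit_orbit_def by auto
  qed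
  moreover have "coprime (x' 0) (int t')"
  proof -
    have "g * gcd (int t') (x' 0) = gcd (g * int t') (g * x' 0)"
      using g0 by (simp add: gcd_mult_left)
    also have "\<dots> = g * 1" using g[of 0] t' x'[of 0] by simp
    finally have "gcd (int t') (x' 0) = 1" using g0 by simp
    then have "coprime (int t') (x' 0)" by (rule coprime_iff_gcd_eq_1[THEN iffD2])
    then show ?thesis by (rule coprime_commute[THEN iffD1])
  qed
  moreover have "t' dvd t" using t' dvd_triv_right[of "int t'" g] int_dvd_int_iff[of t' t] by argo
  ultimately show ?thesis using that by blast
qed

lemma digit_orbit_reduce:
  fixes p k :: "'i \<Rightarrow> nat"
  assumes N: "N \<ge> 2" "b \<ge> 2 * N" and fin: "finite I" and inj: "inj_on p I"
    and pr: "\<And>i. i \<in> I \<Longrightarrow> prime (p i)" "\<And>i. i \<in> I \<Longrightarrow> coprime (p i) b"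
      "\<And>i. i \<in> I \<Longrightarrow> p i \<ge> 5"
    and orb: "digit_orbit N b (\<Prod>i\<in>I. p i ^ k i) x"
  shows "\<exists>x. digit_orbit N b
           (\<Prod>i\<in>I. p i ^ (order_stability b (p i) + multiplicity (p i) (LCM j\<in>I. ord (p j) b))) x"
proof -
  define t where "t = (\<Prod>i\<in>I. p i ^ k i)"
  have t0: "t > 0" unfolding t_def using pr(1) by (intro prod_pos) (auto simp: prime_gt_0_nat)
  have "coprime b (p i ^ k i)" if "i \<in> I" for i
    using pr(2)[OF that] coprime_commute coprime_power_right_iff by blast
  then have "coprime b t" unfolding t_def by (intro prod_coprime_right)
  then obtain t' x' where t': "t' dvd t" "digit_orbit N b t' x'" "coprime (x' 0) (int t')"
    using digit_orbit_cancel_gcd[of N b t x] orb t0 unfolding t_def by blast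
  have t'0: "t' > 0" using t0 t'(1) by (rule dvd_pos_nat)
  define e where "e i = multiplicity (p i) t'" for i
  \<comment> \<open>A divisor of \<open>t\<close> has no primes beyond the \<open>p i\<close>, so t'
    is again a product over \<open>I\<close>, with exponents \<open>e i\<close> that may be
    0.\<close>
  have sub: "prime_factors t' \<subseteq> p ` I"
  proof
    fix q assume "q \<in> prime_factors t'"
    then have q: "prime q" and qt: "q dvd t'" unfolding in_prime_factors_iff by blast+
    have "q dvd (\<Prod>i\<in>I. p i ^ k i)" using dvd_trans[OF qt t'(1)] unfolding t_def .
    then obtain i where i: "i \<in> I" "q dvd p i ^ k i"
      unfolding prime_dvd_prod_iff[OF fin q] by (rule bexE)
    have "q dvd p i" using q i(2) by (rule prime_dvd_power)
    then have "q = p i" by (rule primes_dvd_imp_eq[OF q pr(1)[OF i(1)]])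
    then show "q \<in> p ` I" using i(1) by (rule image_eqI)
  qed
  have "t' = (\<Prod>q\<in>prime_factors t'. q ^ multiplicity q t')"
    using t'0 by (rule prime_factorization_nat)
  also have "\<dots> = (\<Prod>q\<in>p ` I. q ^ multiplicity q t')"
  proof (rule prod.mono_neutral_left)
    show "\<forall>q\<in>p ` I - prime_factors t'. q ^ multiplicity q t' = 1"
    proof
      fix q assume q: "q \<in> p ` I - prime_factors t'"
      then have "prime q" using pr(1) by blast
      then have "\<not> q dvd t'" using q t'0 in_prime_factors_iff[of q t'] by blast
      then show "q ^ multiplicity q t' = 1" by (simp add: not_dvd_imp_multiplicity_0)
    qed
  qed (rule finite_imageI[OF fin], rule sub)
  also have "\<dots> = (\<Prod>i\<in>I. p i ^ e i)"
    using inj by (simp add: prod.reindex e_def)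
  finally have t'_eq: "t' = (\<Prod>i\<in>I. p i ^ e i)" .
  define \<theta> where "\<theta> i = order_stability b (p i) + multiplicity (p i) (LCM j\<in>I. ord (p j) b)" for i
  have le: "e i \<le> \<theta> i" if i: "i \<in> I" for i
  proof (rule ccontr)
    assume "\<not> e i \<le> \<theta> i"
    then have big: "e i > \<theta> i" by simp
    have p2: "p i \<noteq> 2" using pr(3)[OF i] by simp
    have b2: "b \<ge> 2" using N by simp
    obtain T r u where T: "int (p i) * T = int (\<Prod>j\<in>I. p j ^ e j)" "int (p i) dvd T"
        "int b ^ r = 1 + u * T" "\<not> int (p i) dvd u"
      using order_grows_beyond_threshold[of I p b i e, OF fin inj b2 pr(1,2) i p2 big[unfolded \<theta>_def]]
      by blast
    have "\<not> int (p i) dvd x' 0"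
    proof
      assume "int (p i) dvd x' 0"
      moreover have "int (p i) dvd int t'" unfolding t'_eq T(1)[symmetric] by (rule dvd_triv_left)
      ultimately have "is_unit (int (p i))" using coprime_common_divisor[OF t'(3)] by blast
      then show False using pr(3)[OF i] by simp
    qed
    moreover have "int (p i) * T = int t'" using T(1) unfolding t'_eq .
    ultimately show False
      using digit_orbit_no_large_order[OF t'(2) N pr(1)[OF i] pr(3)[OF i] _ T(2) _ T(3,4) t'0] by blast
  qed
  define t\<^sub>0 where "t\<^sub>0 = (\<Prod>i\<in>I. p i ^ \<theta> i)"
  have "t' dvd t\<^sub>0" unfolding t'_eq t\<^sub>0_def using le by (intro prod_dvd_prod le_imp_power_dvd)
  then obtain s where s: "t\<^sub>0 = t' * s" by blast
  have "t\<^sub>0 > 0" unfolding t\<^sub>0_def using pr(1) by (intro prod_pos) (auto simp: prime_gt_0_nat)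
  then have "s > 0" using s by (auto intro!: Nat.gr0I)
  then have "digit_orbit N b (s * t') (\<lambda>j. int s * x' j)" by (rule digit_orbit_scale[OF t'(2)])
  then have "digit_orbit N b t\<^sub>0 (\<lambda>j. int s * x' j)" unfolding s by (simp only: mult.commute)
  then show ?thesis unfolding t\<^sub>0_def \<theta>_def by blast
qed

section \<open>Exponentials and the mask of the digit set\<close>

text \<open>Repeats the exponential of \<open>spectral_pair\<close> literally, so that folding this
  definition restates a spectral pair in terms of \<open>expo\<close>.\<close>

definition expo :: "real \<Rightarrow> real \<Rightarrow> complex" where
  "expo l x = exp (- 2 * complex_of_real pi * \<i> * complex_of_real l * complex_of_real x)"

lemma expo_iexp: "expo l x = iexp ((- 2 * pi * l) * x)"
  unfolding expo_def by (simp add: algebra_simps)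

lemma norm_expo [simp]: "cmod (expo l x) = 1"
  unfolding expo_iexp by simp

lemma cnj_expo: "cnj (expo l x) = expo (- l) x"
  unfolding expo_def by (simp add: exp_cnj)

lemma expo_add: "expo (l + m) x = expo l x * expo m x"
  unfolding expo_def by (simp add: exp_add[symmetric] algebra_simps)

lemma expo_add_right: "expo l (x + y) = expo l x * expo l y"
  unfolding expo_def by (simp add: exp_add[symmetric] algebra_simps)

lemma expo_mult_swap: "expo (l * m) x = expo l (m * x)"
  unfolding expo_def by (simp add: algebra_simps)

lemma expo_0 [simp]: "expo 0 x = 1" "expo l 0 = 1"
  unfolding expo_def by simp_all

lemma expo_mult_cnj: "expo l x * cnj (expo m x) = expo (l - m) x"
  unfolding cnj_expo by (simp add: expo_add[symmetric])

lemma expo_commute: "expo l x = expo x l"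
  unfolding expo_def by (simp add: algebra_simps)

lemma expo_power: "expo l (x * real n) = expo l x ^ n"
  unfolding expo_def by (simp add: exp_of_nat_mult[symmetric] algebra_simps)

lemma expo_eq_1_iff: "expo l x = 1 \<longleftrightarrow> l * x \<in> \<int>"
proof -
  have "expo l x = 1 \<longleftrightarrow> (\<exists>n::int. - 2 * pi * l * x = of_int (2 * n) * pi)"
    unfolding expo_def by (subst exp_eq_1) simp
  also have "\<dots> \<longleftrightarrow> (\<exists>n::int. - (l * x) = of_int n)"
  proof -
    have "(- 2 * pi * l * x = of_int (2 * n) * pi) = (- (l * x) = of_int n)" for n :: int
    proof -
      have "- 2 * pi * l * x = (2 * pi) * (- (l * x))" "of_int (2 * n) * pi = (2 * pi) * of_int n"
        by simp_all
      then show ?thesis by (simp only: mult_cancel_left) simp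
    qed
    then show ?thesis by simp
  qed
  also have "\<dots> \<longleftrightarrow> l * x \<in> \<int>"
    by (metis Ints_cases Ints_minus Ints_of_int minus_minus)
  finally show ?thesis .
qed

lemma continuous_on_expo [continuous_intros]:
  "continuous_on S f \<Longrightarrow> continuous_on S g \<Longrightarrow> continuous_on S (\<lambda>x. expo (f x) (g x))"
  unfolding expo_def by (intro continuous_intros)

lemma borel_measurable_expo [measurable]: "expo l \<in> borel_measurable borel"
  by (intro borel_measurable_continuous_onI continuous_intros)

text \<open>The Fourier transform of the uniform measure on {0, ..., N - 1}. The factor q of the
  scaled digits disappears into the argument, because q * \<xi> / b = \<xi> / N.\<close>

definition mask :: "nat \<Rightarrow> real \<Rightarrow> complex" where
  "mask N y = (\<Sum>d<N. expo y (real d)) / of_nat N"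

lemma mask_add_int: "mask N (y + of_int k) = mask N y"
proof -
  have "expo (of_int k) (real d) = 1" for d
    unfolding expo_eq_1_iff by (metis Ints_mult Ints_of_int Ints_of_nat)
  then show ?thesis unfolding mask_def by (simp add: expo_add)
qed

lemma norm_mask_le: "cmod (mask N y) \<le> 1"
proof -
  have "cmod (\<Sum>d<N. expo y (real d)) \<le> (\<Sum>d<N. 1)"
    by (rule order.trans[OF norm_sum]) simp
  then show ?thesis unfolding mask_def by (cases "N = 0") (auto simp: norm_divide)
qed

text \<open>The geometric sum in z = \<open>expo y 1\<close> divides z^N - 1, so a zero makes z an
  N-th root of unity.\<close>

lemma mask_eq_0_imp:
  assumes "mask N y = 0" "N \<ge> 1"
  shows "real N * y \<in> \<int>"
proof -
  define z where "z = expo y 1"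
  have "expo y (real d) = z ^ d" for d using expo_power[of y 1 d] by (simp add: z_def)
  then have "(\<Sum>d<N. z ^ d) = 0" using assms unfolding mask_def by simp
  then have "z ^ N = 1" using power_diff_1_eq[of z N] by simp
  then have "expo y (real N) = 1" using expo_power[of y 1 N] by (simp add: z_def)
  then show ?thesis unfolding expo_eq_1_iff by (simp add: mult.commute)
qed

section \<open>Centered digits as a complete residue system modulo \<open>N\<close>\<close>

lemma centered_digits_eq_image:
  "centered_digits N = (\<lambda>k. (- int N) div 2 + 1 + int k) ` {..<N}"
proof (intro equalityI subsetI)
  fix c assume "c \<in> centered_digits N"
  then have c: "- int N < 2 * c" "2 * c \<le> int N" unfolding centered_digits_def by auto
  define k where "k = nat (c - ((- int N) div 2 + 1))"
  have "c - ((- int N) div 2 + 1) \<ge> 0" "c - ((- int N) div 2 + 1) < int N" using c by linarith+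
  then have "c = (- int N) div 2 + 1 + int k" "k < N" unfolding k_def by auto
  then show "c \<in> (\<lambda>k. (- int N) div 2 + 1 + int k) ` {..<N}" by blast
next
  fix c assume "c \<in> (\<lambda>k. (- int N) div 2 + 1 + int k) ` {..<N}"
  then obtain k where k: "c = (- int N) div 2 + 1 + int k" "k < N" by blast
  have "- int N < 2 * c" using k by linarith
  moreover have "2 * c \<le> int N" using k by linarith
  ultimately show "c \<in> centered_digits N" unfolding centered_digits_def by simp
qed

lemma finite_centered_digits [simp]: "finite (centered_digits N)"
  unfolding centered_digits_eq_image by simp

lemma card_centered_digits: "card (centered_digits N) = N"
  unfolding centered_digits_eq_image by (subst card_image) (auto simp: inj_on_def)

lemma zero_in_centered_digits [simp]: "N \<ge> 1 \<Longrightarrow> 0 \<in> centered_digits N"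
  unfolding centered_digits_def by simp

lemma sum_expo_centered_digits:
  assumes "N \<ge> 1" "\<not> int N dvd a"
  shows "(\<Sum>c\<in>centered_digits N. expo (of_int c / real N) (of_int a)) = 0"
proof -
  define s where "s = (- int N) div 2 + 1"
  define w where "w = expo (1 / real N) (of_int a)"
  have *: "expo (of_int (s + int k) / real N) (of_int a) = expo (of_int s / real N) (of_int a) * w ^ k" for k
  proof -
    have "expo (real k / real N) (of_int a) = expo (1 / real N) (of_int a * real k)"
      using expo_mult_swap[of "1 / real N" "real k" "of_int a"] by (simp add: mult.commute)
    then have "expo (real k / real N) (of_int a) = w ^ k" by (simp add: w_def expo_power)
    then show ?thesis by (simp add: add_divide_distrib expo_add)
  qed
  have "w ^ N = 1"
    unfolding w_def expo_power[symmetric] expo_eq_1_iff using assms(1) by simp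
  moreover have "w \<noteq> 1"
  proof
    assume "w = 1"
    then obtain k where "of_int a / real N = of_int k"
      unfolding w_def expo_eq_1_iff by (auto elim: Ints_cases)
    then have "real_of_int a = of_int (int N * k)" using assms(1) by (simp add: field_simps)
    then have "a = int N * k" by (simp only: of_int_eq_iff)
    then show False using assms(2) by simp
  qed
  ultimately have "(\<Sum>k<N. w ^ k) = 0" by (simp add: geometric_sum)
  moreover have "(\<Sum>c\<in>centered_digits N. expo (of_int c / real N) (of_int a))
      = (\<Sum>k<N. expo (of_int (s + int k) / real N) (of_int a))"
    unfolding centered_digits_eq_image s_def by (subst sum.reindex) (auto simp: inj_on_def)
  ultimately show ?thesis unfolding * by (simp add: sum_distrib_left[symmetric])
qed

text \<open>Parseval on the integers modulo \<open>N\<close>: expand |mask|^2 over pairs d, d';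
  summing over the digits kills every pair with d different from d', because they form a complete
  residue system and \<open>t\<close> is prime to \<open>N\<close>.\<close>

lemma sum_mask_squared:
  assumes "N \<ge> 1" "coprime t N"
  shows "(\<Sum>c\<in>centered_digits N. (cmod (mask N ((\<xi> + real t * of_int c) / real N)))\<^sup>2) = 1"
proof -
  define y where "y c = (\<xi> + real t * of_int c) / real N" for c :: int
  have N0: "complex_of_nat N \<noteq> 0" using assms(1) by simp
  have inner: "(\<Sum>c\<in>centered_digits N. expo (y c) (real d - real d')) = (if d = d' then of_nat N else 0)"
    if "d < N" "d' < N" for d d'
  proof (cases "d = d'")
    case False
    have "expo (y c) (real d - real d')
        = expo (\<xi> / real N) (real d - real d') * expo (of_int c / real N) (of_int (int t * (int d - int d')))" for c
    proof -
      have "expo (real t * of_int c / real N) (real d - real d')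
          = expo (of_int c / real N) (of_int (int t * (int d - int d')))"
        using expo_mult_swap[of "of_int c / real N" "real t" "real d - real d'"] by (simp add: mult.commute)
      then show ?thesis unfolding y_def by (simp add: add_divide_distrib expo_add)
    qed
    moreover have "\<not> int N dvd int t * (int d - int d')"
    proof
      assume "int N dvd int t * (int d - int d')"
      moreover have "coprime (int N) (int t)" using assms(2) coprime_commute by auto
      ultimately have "int N dvd int d - int d'" using coprime_dvd_mult_right_iff by blast
      then have "\<bar>int N\<bar> \<le> \<bar>int d - int d'\<bar>" using False by (intro dvd_imp_le_int) auto
      then show False using that by linarith
    qed
    then have "(\<Sum>c\<in>centered_digits N. expo (of_int c / real N) (of_int (int t * (int d - int d')))) = 0"
      by (rule sum_expo_centered_digits[OF assms(1)])
    ultimately show ?thesis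
      using False by (simp only: sum_distrib_left[symmetric] mult_zero_right if_False)
  qed (simp add: card_centered_digits)
  have sq: "complex_of_real ((cmod (mask N (y c)))\<^sup>2)
      = (\<Sum>d<N. \<Sum>d'<N. expo (y c) (real d - real d')) / (of_nat N)\<^sup>2" for c
  proof -
    have "expo (y c) (real d) * cnj (expo (y c) (real d')) = expo (y c) (real d - real d')" for d d'
      unfolding expo_commute[of "y c"] by (rule expo_mult_cnj)
    then show ?thesis
      unfolding complex_norm_square mask_def
      by (simp add: sum_product power2_eq_square)
  qed
  have "complex_of_real (\<Sum>c\<in>centered_digits N. (cmod (mask N (y c)))\<^sup>2)
      = (\<Sum>c\<in>centered_digits N. \<Sum>d<N. \<Sum>d'<N. expo (y c) (real d - real d')) / (of_nat N)\<^sup>2"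
    unfolding of_real_sum sq by (simp add: sum_divide_distrib)
  also have "(\<Sum>c\<in>centered_digits N. \<Sum>d<N. \<Sum>d'<N. expo (y c) (real d - real d'))
      = (\<Sum>d<N. \<Sum>d'<N. \<Sum>c\<in>centered_digits N. expo (y c) (real d - real d'))"
    by (subst sum.swap, rule sum.cong[OF refl], rule sum.swap)
  also have "\<dots> = (\<Sum>d<N. \<Sum>d'<N. if d = d' then of_nat N else 0)"
    by (intro sum.cong refl inner) auto
  also have "\<dots> = (of_nat N)\<^sup>2" by (simp add: power2_eq_square)
  finally have "complex_of_real (\<Sum>c\<in>centered_digits N. (cmod (mask N (y c)))\<^sup>2) = complex_of_real 1"
    using N0 by simp
  then show ?thesis unfolding y_def of_real_eq_iff .
qed

section \<open>Self-similar measures\<close>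

definition fourier :: "real measure \<Rightarrow> real \<Rightarrow> complex" where
  "fourier M \<xi> = (LINT x|M. expo \<xi> x)"

lemma measurable_affine_pair:
  fixes M :: "real measure" and Q :: "real pmf"
  assumes "sets M = sets borel"
  shows "(\<lambda>p. (snd p + fst p) / \<rho>) \<in> borel_measurable (measure_pmf Q \<Otimes>\<^sub>M M)"
proof -
  have "(\<lambda>p. fst p) \<in> measurable (measure_pmf Q \<Otimes>\<^sub>M M) (measure_pmf Q)" by (rule measurable_fst)
  from measurable_compose[OF this, of "\<lambda>a. a" borel]
  have [measurable]: "fst \<in> borel_measurable (measure_pmf Q \<Otimes>\<^sub>M M)" by simp
  have "(\<lambda>p. snd p) \<in> measurable (measure_pmf Q \<Otimes>\<^sub>M M) M" by (rule measurable_snd)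
  then have [measurable]: "snd \<in> borel_measurable (measure_pmf Q \<Otimes>\<^sub>M M)"
    using measurable_cong_sets[OF refl assms] by blast
  show ?thesis by (intro borel_measurable_divide borel_measurable_add borel_measurable_const) measurable
qed

text \<open>Reads the averaged identity as the law of (x + a) / \<rho> with \<open>a\<close> uniform
  on \<open>B\<close> and x independent with law \<open>M\<close>; integrals against
  \<open>M\<close> then follow from Fubini.\<close>

lemma self_similar_measure_mixture:
  assumes "is_self_similar_measure \<rho> B M" and B: "finite B" "B \<noteq> {}"
  shows "M = distr (measure_pmf (pmf_of_set B) \<Otimes>\<^sub>M M) borel (\<lambda>(a, x). (x + a) / \<rho>)"
proof -
  have M: "prob_space M" "sets M = sets borel"
    and self: "\<And>E. E \<in> sets borel \<Longrightarrow>
      measure M E = (1 / real (card B)) * (\<Sum>a\<in>B. measure M ((\<lambda>x. (x + a) / \<rho>) -` E))"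
    using assms(1) unfolding is_self_similar_measure_def by auto
  interpret M: prob_space M by (rule M(1))
  have [measurable_cong]: "sets M = sets borel" by (rule M(2))
  have space_M: "space M = UNIV" using sets_eq_imp_space_eq[OF M(2)] by simp
  let ?P = "measure_pmf (pmf_of_set B)"
  interpret P: pair_prob_space ?P M ..
  have phi [measurable]: "(\<lambda>(a, x). (x + a) / \<rho>) \<in> borel_measurable (?P \<Otimes>\<^sub>M M)"
  proof -
    show ?thesis using measurable_affine_pair[OF M(2)] by (simp add: case_prod_unfold)
  qed
  show ?thesis
  proof (rule measure_eqI)
    fix E assume "E \<in> sets M"
    then have E [measurable]: "E \<in> sets borel" using M(2) by simp
    have slice: "(\<lambda>x. (x + a) / \<rho>) -` E \<in> sets M" for a
      using measurable_sets[of "\<lambda>x. (x + a) / \<rho>" M borel E] E space_M by simp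
    have "emeasure (distr (?P \<Otimes>\<^sub>M M) borel (\<lambda>(a, x). (x + a) / \<rho>)) E
        = emeasure (?P \<Otimes>\<^sub>M M) ((\<lambda>(a, x). (x + a) / \<rho>) -` E \<inter> space (?P \<Otimes>\<^sub>M M))"
      using E phi by (intro emeasure_distr)
    also have "\<dots> = (\<integral>\<^sup>+a. emeasure M (Pair a -` ((\<lambda>(a, x). (x + a) / \<rho>) -` E \<inter> space (?P \<Otimes>\<^sub>M M))) \<partial>?P)"
      by (rule M.emeasure_pair_measure_alt) (rule measurable_sets[OF phi E])
    also have "\<dots> = (\<integral>\<^sup>+a. emeasure M ((\<lambda>x. (x + a) / \<rho>) -` E) \<partial>?P)"
      by (intro nn_integral_cong arg_cong[where f="emeasure M"]) (auto simp: space_pair_measure space_M)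
    also have "\<dots> = (\<Sum>a\<in>B. emeasure M ((\<lambda>x. (x + a) / \<rho>) -` E)) / card B"
      using B by (simp add: nn_integral_pmf_of_set)
    also have "\<dots> = ennreal ((\<Sum>a\<in>B. measure M ((\<lambda>x. (x + a) / \<rho>) -` E)) / card B)"
      using B by (simp add: M.emeasure_eq_measure divide_ennreal[symmetric] ennreal_of_nat_eq_real_of_nat
          sum_nonneg card_gt_0_iff)
    also have "\<dots> = emeasure M E" using self[OF E] by (simp add: M.emeasure_eq_measure)
    finally show "emeasure M E = emeasure (distr (?P \<Otimes>\<^sub>M M) borel (\<lambda>(a, x). (x + a) / \<rho>)) E" by simp
  qed (simp add: M(2))
qed

lemma fourier_self_similar:
  assumes "is_self_similar_measure \<rho> B M" and B: "finite B" "B \<noteq> {}"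
  shows "fourier M \<xi> = (\<Sum>a\<in>B. expo (\<xi> / \<rho>) a) / card B * fourier M (\<xi> / \<rho>)"
proof -
  have M: "prob_space M" "sets M = sets borel"
    using assms(1) unfolding is_self_similar_measure_def by auto
  interpret M: prob_space M by (rule M(1))
  have [measurable_cong]: "sets M = sets borel" by (rule M(2))
  let ?P = "measure_pmf (pmf_of_set B)"
  interpret P: pair_prob_space ?P M ..
  have phi [measurable]: "(\<lambda>p. (snd p + fst p) / \<rho>) \<in> borel_measurable (?P \<Otimes>\<^sub>M M)"
    by (rule measurable_affine_pair[OF M(2)])
  have "fourier M \<xi> = (LINT x|distr (?P \<Otimes>\<^sub>M M) borel (\<lambda>p. (snd p + fst p) / \<rho>). expo \<xi> x)"
    unfolding fourier_def
    by (subst self_similar_measure_mixture[OF assms]) (simp add: case_prod_unfold)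
  also have "\<dots> = (LINT p|(?P \<Otimes>\<^sub>M M). expo \<xi> ((snd p + fst p) / \<rho>))"
    by (rule integral_distr) measurable
  also have "\<dots> = (LINT a|?P. LINT x|M. expo \<xi> ((x + a) / \<rho>))"
  proof -
    have "integrable (?P \<Otimes>\<^sub>M M) (\<lambda>(a, x). expo \<xi> ((x + a) / \<rho>))"
      by (rule P.P.integrable_const_bound[where B=1]) (auto simp: case_prod_unfold)
    from P.integral_fst'[OF this] show ?thesis by (simp add: case_prod_unfold)
  qed
  also have "\<dots> = (LINT a|?P. expo (\<xi> / \<rho>) a * fourier M (\<xi> / \<rho>))"
  proof (intro Bochner_Integration.integral_cong refl)
    fix a
    have "expo \<xi> ((x + a) / \<rho>) = expo (\<xi> / \<rho>) a * expo (\<xi> / \<rho>) x" for x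
      using expo_mult_swap[of \<xi> "1 / \<rho>" "x + a"] by (simp add: expo_add_right mult.commute)
    then show "(LINT x|M. expo \<xi> ((x + a) / \<rho>)) = expo (\<xi> / \<rho>) a * fourier M (\<xi> / \<rho>)"
      unfolding fourier_def by simp
  qed
  also have "\<dots> = (\<Sum>a\<in>B. expo (\<xi> / \<rho>) a * fourier M (\<xi> / \<rho>)) / card B"
  proof -
    have "(LINT a|?P. expo (\<xi> / \<rho>) a * fourier M (\<xi> / \<rho>))
        = (\<Sum>a\<in>B. pmf (pmf_of_set B) a *\<^sub>R (expo (\<xi> / \<rho>) a * fourier M (\<xi> / \<rho>)))"
      using B by (intro integral_measure_pmf) auto
    also have "\<dots> = (\<Sum>a\<in>B. (expo (\<xi> / \<rho>) a * fourier M (\<xi> / \<rho>)) / card B)"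
      using B by (intro sum.cong refl) (simp add: pmf_of_set scaleR_conv_of_real divide_simps)
    finally show ?thesis by (simp add: sum_divide_distrib)
  qed
  finally show ?thesis by (simp add: sum_distrib_right)
qed

lemma fourier_char: "fourier M \<xi> = char M (- 2 * pi * \<xi>)"
  unfolding fourier_def char_def expo_iexp by simp

lemma real_distribution_self_similar:
  assumes "is_self_similar_measure \<rho> B M"
  shows "real_distribution M"
proof -
  have M: "prob_space M" "sets M = sets borel"
    using assms unfolding is_self_similar_measure_def by auto
  then show ?thesis
    unfolding real_distribution_def real_distribution_axioms_def
    using sets_eq_imp_space_eq[OF M(2)] by simp
qed

section \<open>Uniqueness and existence of the self-similar measure\<close>

lemma tendsto_scale_down:
  assumes "\<rho> > (1::real)"
  shows "(\<lambda>n. \<xi> / \<rho> ^ n) \<longlonglongrightarrow> 0"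
proof -
  have "(\<lambda>n. \<xi> * (1 / \<rho>) ^ n) \<longlonglongrightarrow> \<xi> * 0"
    using assms by (intro tendsto_mult tendsto_const LIMSEQ_power_zero) simp
  then show ?thesis by (simp add: power_one_over field_simps)
qed

text \<open>Iterating the Fourier recursion leaves a product \<open>P\<close>, common to both
  measures, times a tail factor that tends to 1; characteristic functions determine the
  measure.\<close>

lemma self_similar_measure_unique:
  assumes "is_self_similar_measure \<rho> B M1" "is_self_similar_measure \<rho> B M2"
    and B: "finite B" "B \<noteq> {}" and \<rho>: "\<rho> > 1"
  shows "M1 = M2"
proof (rule Levy_uniqueness)
  show 1: "real_distribution M1" and 2: "real_distribution M2"
    using assms(1,2) real_distribution_self_similar by auto
  interpret M1: real_distribution M1 by (rule 1)
  interpret M2: real_distribution M2 by (rule 2)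
  define P where "P \<xi> n = (\<Prod>j<n. (\<Sum>a\<in>B. expo (\<xi> / \<rho> ^ Suc j) a) / card B)" for \<xi> n
  have prod: "fourier M \<xi> = P \<xi> n * fourier M (\<xi> / \<rho> ^ n)"
    if "is_self_similar_measure \<rho> B M" for M \<xi> n
  proof (induction n)
    case (Suc n)
    have "fourier M (\<xi> / \<rho> ^ n)
        = (\<Sum>a\<in>B. expo (\<xi> / \<rho> ^ Suc n) a) / card B * fourier M (\<xi> / \<rho> ^ Suc n)"
      using fourier_self_similar[OF that B, of "\<xi> / \<rho> ^ n"] by (simp add: field_simps)
    then show ?case using Suc by (simp add: P_def)
  qed (simp add: P_def)
  have lim: "(\<lambda>n. fourier M (\<xi> / \<rho> ^ n)) \<longlonglongrightarrow> 1" if "real_distribution M" for M \<xi>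
  proof -
    interpret real_distribution M by (rule that)
    have "(\<lambda>n. - 2 * pi * (\<xi> / \<rho> ^ n)) \<longlonglongrightarrow> - 2 * pi * 0"
      using \<rho> by (intro tendsto_mult tendsto_const tendsto_scale_down)
    then have "(\<lambda>n. char M (- 2 * pi * (\<xi> / \<rho> ^ n))) \<longlonglongrightarrow> char M 0"
      using isCont_tendsto_compose[OF isCont_char] by simp
    then show ?thesis by (simp add: fourier_char char_zero)
  qed
  have eq: "fourier M1 \<xi> = fourier M2 \<xi>" for \<xi>
  proof -
    \<comment> \<open>Multiplying each expansion by the tail factor of the other measure makes the
      two sequences identical, so their limits agree.\<close>
    have "(\<lambda>n. P \<xi> n * fourier M1 (\<xi> / \<rho> ^ n) * fourier M2 (\<xi> / \<rho> ^ n)) \<longlonglongrightarrow> fourier M1 \<xi> * 1"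
      unfolding prod[OF assms(1), symmetric] by (intro tendsto_mult tendsto_const lim 2)
    moreover have "(\<lambda>n. P \<xi> n * fourier M2 (\<xi> / \<rho> ^ n) * fourier M1 (\<xi> / \<rho> ^ n)) \<longlonglongrightarrow> fourier M2 \<xi> * 1"
      unfolding prod[OF assms(2), symmetric] by (intro tendsto_mult tendsto_const lim 1)
    ultimately show ?thesis by (simp add: ac_simps LIMSEQ_unique)
  qed
  show "char M1 = char M2"
  proof
    fix s
    show "char M1 s = char M2 s" using eq[of "- s / (2 * pi)"] by (simp add: fourier_char)
  qed
qed

text \<open>The measure is the law of the random series of a_k / \<rho>^(k+1) with independent
  letters a_k uniform on \<open>B\<close>; conditioning on the first letter gives the
  self-similarity.\<close>

lemma self_similar_measure_exists:
  assumes B: "finite B" "B \<noteq> {}" and \<rho>: "\<rho> > 1"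
  shows "\<exists>M. is_self_similar_measure \<rho> B M"
proof -
  let ?P = "measure_pmf (pmf_of_set B)"
  let ?S = "stream_space ?P"
  \<comment> \<open>A stream may contain any real letter; sending those outside \<open>B\<close> to
    0 makes the series converge for every stream, not only almost surely.\<close>
  define g where "g a = (if a \<in> B then a else 0)" for a :: real
  define K where "K = Max (abs ` B)"
  have K: "\<bar>g a\<bar> \<le> \<bar>K\<bar>" for a
    unfolding K_def g_def using B(1) by (auto intro: order.trans[OF Max_ge abs_ge_self])
  define X where "X \<omega> = (\<Sum>k. g (\<omega> !! k) / \<rho> ^ Suc k)" for \<omega>
  have summ: "summable (\<lambda>k. g (\<omega> !! k) / \<rho> ^ Suc k)" for \<omega>
  proof (rule summable_comparison_test')
    show "summable (\<lambda>k. \<bar>K\<bar> * (1 / \<rho>) ^ Suc k)"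
      using \<rho> by (intro summable_mult summable_Suc_iff[THEN iffD2] summable_geometric) simp
    fix k :: nat
    show "norm (g (\<omega> !! k) / \<rho> ^ Suc k) \<le> \<bar>K\<bar> * (1 / \<rho>) ^ Suc k"
      using \<rho> K[of "\<omega> !! k"] by (simp add: abs_mult power_one_over divide_simps)
  qed
  have shift: "X (a ## \<omega>) = (X \<omega> + g a) / \<rho>" for a \<omega>
  proof -
    have "X (a ## \<omega>) = g a / \<rho> + (\<Sum>k. g (\<omega> !! k) / \<rho> ^ Suc (Suc k))"
      using suminf_split_head[OF summ[of "a ## \<omega>"]] unfolding X_def by simp
    also have "(\<Sum>k. g (\<omega> !! k) / \<rho> ^ Suc (Suc k)) = (\<Sum>k. g (\<omega> !! k) / \<rho> ^ Suc k / \<rho>)"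
      by (simp add: field_simps)
    also have "\<dots> = X \<omega> / \<rho>" unfolding X_def by (rule suminf_divide[OF summ])
    finally show ?thesis by (simp add: add_divide_distrib)
  qed
  have [measurable]: "g \<in> measurable ?P borel" by simp
  have X [measurable]: "X \<in> borel_measurable ?S" unfolding X_def by measurable
  interpret S: prob_space ?S by (rule prob_space.prob_space_stream_space[OF prob_space_measure_pmf])
  define M where "M = distr ?S borel X"
  interpret M: prob_space M unfolding M_def by (rule S.prob_space_distr) (rule X)
  have em: "emeasure M E = emeasure ?S (X -` E \<inter> space ?S)" if "E \<in> sets borel" for E
    unfolding M_def using that by (intro emeasure_distr X)
  have "measure M E = (1 / real (card B)) * (\<Sum>a\<in>B. measure M ((\<lambda>x. (x + a) / \<rho>) -` E))"
    if E: "E \<in> sets borel" for E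
  proof -
    have slice: "(\<lambda>x. (x + a) / \<rho>) -` E \<in> sets borel" for a
      using measurable_sets[of "\<lambda>x::real. (x + a) / \<rho>" borel borel E] E by simp
    have "emeasure M E = (\<integral>\<^sup>+a. emeasure ?S {\<omega> \<in> space ?S. a ## \<omega> \<in> X -` E \<inter> space ?S} \<partial>?P)"
      unfolding em[OF E] by (rule prob_space.emeasure_stream_space[OF prob_space_measure_pmf]) (rule measurable_sets[OF X E])
    also have "\<dots> = (\<Sum>a\<in>B. emeasure ?S {\<omega> \<in> space ?S. a ## \<omega> \<in> X -` E \<inter> space ?S}) / card B"
      using B by (simp add: nn_integral_pmf_of_set)
    also have "(\<Sum>a\<in>B. emeasure ?S {\<omega> \<in> space ?S. a ## \<omega> \<in> X -` E \<inter> space ?S})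
        = (\<Sum>a\<in>B. emeasure M ((\<lambda>x. (x + a) / \<rho>) -` E))"
    proof (intro sum.cong refl)
      fix a assume a: "a \<in> B"
      have "{\<omega> \<in> space ?S. a ## \<omega> \<in> X -` E \<inter> space ?S} = X -` ((\<lambda>x. (x + a) / \<rho>) -` E) \<inter> space ?S"
        using a by (auto simp: shift g_def space_stream_space)
      then show "emeasure ?S {\<omega> \<in> space ?S. a ## \<omega> \<in> X -` E \<inter> space ?S} = emeasure M ((\<lambda>x. (x + a) / \<rho>) -` E)"
        by (simp add: em[OF slice])
    qed
    finally have "ennreal (measure M E) = ennreal ((\<Sum>a\<in>B. measure M ((\<lambda>x. (x + a) / \<rho>) -` E)) / card B)"
      using B by (simp add: M.emeasure_eq_measure divide_ennreal[symmetric] ennreal_of_nat_eq_real_of_nat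
          sum_nonneg card_gt_0_iff)
    then show ?thesis by (simp add: sum_nonneg)
  qed
  moreover have "sets M = sets borel" by (simp add: M_def)
  ultimately show ?thesis
    unfolding is_self_similar_measure_def using M.prob_space_axioms by blast
qed

lemma is_self_similar_measure_self_similar_measure:
  assumes "finite B" "B \<noteq> {}" "\<rho> > 1"
  shows "is_self_similar_measure \<rho> B (self_similar_measure \<rho> B)"
proof -
  obtain M where M: "is_self_similar_measure \<rho> B M"
    using self_similar_measure_exists[OF assms] by blast
  show ?thesis
    unfolding self_similar_measure_def
    by (rule theI[of _ M]) (use M self_similar_measure_unique[OF _ _ assms] in blast)+
qed

section \<open>Density of trigonometric sums\<close>

text \<open>Terms are added one at a time and frequencies may repeat, so closure properties follow
  by induction without merging index sets.\<close>

inductive_set trig_span :: "real set \<Rightarrow> (real \<Rightarrow> complex) set" for I where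
  zero: "(\<lambda>x. 0) \<in> trig_span I"
| step: "f \<in> trig_span I \<Longrightarrow> i \<in> I \<Longrightarrow> (\<lambda>x. f x + c * expo i x) \<in> trig_span I"

text \<open>Returns to the form demanded by \<open>L2_orthonormal_basis\<close>: a repeated
  frequency adds to the coefficient it already has.\<close>

lemma trig_span_representation:
  assumes "f \<in> trig_span I"
  shows "\<exists>F c. finite F \<and> F \<subseteq> I \<and> f = (\<lambda>x. \<Sum>i\<in>F. c i * expo i x)"
  using assms
proof (induction rule: trig_span.induct)
  case zero
  show ?case by (intro exI[of _ "{}"]) auto
next
  case (step f i a)
  then obtain F c where F: "finite F" "F \<subseteq> I" "f = (\<lambda>x. \<Sum>i\<in>F. c i * expo i x)" by blast
  define c' where "c' j = (if j \<in> F then c j else 0) + (if j = i then a else 0)" for j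
  have "f x + a * expo i x = (\<Sum>j\<in>insert i F. c' j * expo j x)" for x
  proof -
    have "(\<Sum>j\<in>insert i F. c' j * expo j x)
        = (\<Sum>j\<in>insert i F. (if j \<in> F then c j else 0) * expo j x)
          + (\<Sum>j\<in>insert i F. (if j = i then a else 0) * expo j x)"
      unfolding c'_def by (simp only: distrib_right sum.distrib)
    also have "(\<Sum>j\<in>insert i F. (if j \<in> F then c j else 0) * expo j x) = (\<Sum>j\<in>F. c j * expo j x)"
      using F(1) by (intro sum.mono_neutral_cong_right) auto
    also have "(\<Sum>j\<in>insert i F. (if j = i then a else 0) * expo j x) = (\<Sum>j\<in>{i}. a * expo j x)"
      using F(1) by (intro sum.mono_neutral_cong_right) auto
    finally show ?thesis by (simp add: F(3))
  qed
  then show ?case using F(1,2) step.hyps by (intro exI[of _ "insert i F"] exI[of _ c']) auto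
qed

lemma trig_span_sum:
  assumes "finite F" "F \<subseteq> I"
  shows "(\<lambda>x. \<Sum>i\<in>F. c i * expo i x) \<in> trig_span I"
  using assms
proof (induction F rule: finite_induct)
  case (insert i F)
  then have "(\<lambda>x. (\<Sum>i\<in>F. c i * expo i x) + c i * expo i x) \<in> trig_span I"
    by (intro trig_span.step) auto
  then show ?case using insert.hyps by (simp add: add.commute)
qed (simp add: trig_span.zero)

lemma trig_span_add:
  assumes "f \<in> trig_span I" "g \<in> trig_span I"
  shows "(\<lambda>x. f x + g x) \<in> trig_span I"
  using assms(2)
proof (induction rule: trig_span.induct)
  case (step g i c)
  then have "(\<lambda>x. (f x + g x) + c * expo i x) \<in> trig_span I" by (intro trig_span.step)
  then show ?case by (simp add: add.assoc)
qed (use assms(1) in simp)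

lemma trig_span_scale:
  assumes "f \<in> trig_span I"
  shows "(\<lambda>x. a * f x) \<in> trig_span I"
  using assms
proof (induction rule: trig_span.induct)
  case (step g i c)
  then have "(\<lambda>x. a * g x + (a * c) * expo i x) \<in> trig_span I" by (intro trig_span.step)
  then show ?case by (simp add: distrib_left mult.assoc)
qed (use trig_span.zero in simp)

lemma trig_span_expo: "i \<in> I \<Longrightarrow> (\<lambda>x. c * expo i x) \<in> trig_span I"
  using trig_span.step[OF trig_span.zero, of i I c] by simp

lemma trig_span_const: "(\<lambda>x. c) \<in> trig_span UNIV"
  using trig_span_expo[of 0 UNIV c] by simp

lemma trig_span_mult_expo:
  assumes "f \<in> trig_span UNIV"
  shows "(\<lambda>x. f x * (c * expo j x)) \<in> trig_span UNIV"
  using assms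
proof (induction rule: trig_span.induct)
  case (step g i a)
  then have "(\<lambda>x. g x * (c * expo j x) + (a * c) * expo (i + j) x) \<in> trig_span UNIV"
    by (intro trig_span.step) auto
  moreover have "g x * (c * expo j x) + (a * c) * expo (i + j) x = (g x + a * expo i x) * (c * expo j x)" for x
    by (simp add: expo_add algebra_simps)
  ultimately show ?case by simp
qed (use trig_span.zero in simp)

lemma trig_span_mult:
  assumes "f \<in> trig_span UNIV" "g \<in> trig_span UNIV"
  shows "(\<lambda>x. f x * g x) \<in> trig_span UNIV"
  using assms(2)
proof (induction rule: trig_span.induct)
  case (step g i c)
  then have "(\<lambda>x. f x * g x + f x * (c * expo i x)) \<in> trig_span UNIV"
    by (intro trig_span_add trig_span_mult_expo[OF assms(1)])
  then show ?case by (simp add: distrib_left)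
qed (use trig_span.zero in simp)

lemma continuous_on_trig_span: "f \<in> trig_span I \<Longrightarrow> continuous_on S f"
  by (induction rule: trig_span.induct) (auto intro!: continuous_intros)

lemma bounded_trig_span: "f \<in> trig_span I \<Longrightarrow> \<exists>B. \<forall>x. cmod (f x) \<le> B"
proof (induction rule: trig_span.induct)
  case (step f i c)
  then obtain B where B: "\<And>x. cmod (f x) \<le> B" by blast
  have "cmod (f x + c * expo i x) \<le> B + cmod c" for x
    using norm_triangle_ineq[of "f x" "c * expo i x"] B[of x] by (simp add: norm_mult)
  then show ?case by blast
qed auto

text \<open>Stone-Weierstrass for the real functions whose complex embedding is a trigonometric sum;
  they form an algebra because frequencies add under multiplication.\<close>

lemma trig_span_approximates_continuous:
  assumes K: "compact K" and h: "continuous_on K (h :: real \<Rightarrow> real)" and e: "e > 0"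
  shows "\<exists>g\<in>trig_span UNIV. \<forall>x\<in>K. cmod (complex_of_real (h x) - g x) < e"
proof -
  define P where "P g \<longleftrightarrow> (\<lambda>x. complex_of_real (g x)) \<in> trig_span UNIV" for g :: "real \<Rightarrow> real"
  have "\<exists>g. P g \<and> (\<forall>x\<in>K. \<bar>h x - g x\<bar> < e)"
  proof (rule Stone_Weierstrass_HOL[OF K])
    show "P (\<lambda>x. c)" for c unfolding P_def by (rule trig_span_const)
    show "continuous_on K g" if "P g" for g
    proof -
      have "continuous_on K (\<lambda>x. Re (complex_of_real (g x)))"
        using that unfolding P_def by (intro continuous_intros continuous_on_trig_span)
      then show ?thesis by simp
    qed
    show "P (\<lambda>x. f x + g x)" if "P f \<and> P g" for f g
      using that trig_span_add unfolding P_def by fastforce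
    show "P (\<lambda>x. f x * g x)" if "P f \<and> P g" for f g
      using that trig_span_mult unfolding P_def by fastforce
    show "\<exists>g. P g \<and> g x \<noteq> g y" if xy: "x \<in> K \<and> y \<in> K \<and> x \<noteq> y" for x y
    proof -
      \<comment> \<open>Half a period of cos(2 pi l (z - x)) fits between x and y: the value is 1 at
        x and -1 at y.\<close>
      define l where "l = 1 / (2 * (y - x))"
      define g where "g z = Re (expo l (z - x))" for z
      have "complex_of_real (g z) = (1 / 2 * expo l (- x)) * expo l z + (1 / 2 * expo (- l) (- x)) * expo (- l) z" for z
      proof -
        have "complex_of_real (g z) = (expo l (z - x) + cnj (expo l (z - x))) / 2"
          unfolding g_def by (simp add: complex_add_cnj)
        then show ?thesis
          unfolding cnj_expo using expo_add_right[of _ z "- x"]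
          by (simp add: add_divide_distrib mult.commute)
      qed
      then have "P g"
        unfolding P_def by (simp only:) (intro trig_span_add trig_span_expo UNIV_I)
      moreover have "g x = 1" unfolding g_def by simp
      moreover have "g y = - 1"
      proof -
        have "l * (y - x) = 1 / 2" using xy by (simp add: l_def field_simps)
        then have "(- 2 * pi) * (l * (y - x)) = - pi" by (simp only:)
        then have "(- 2 * pi * l) * (y - x) = - pi" by (simp only: mult.assoc)
        then show ?thesis unfolding g_def expo_iexp by (simp only: Re_exp) simp
      qed
      ultimately show ?thesis by (intro exI[of _ g]) simp
    qed
  qed (use h e in auto)
  then obtain g where g: "P g" "\<And>x. x \<in> K \<Longrightarrow> \<bar>h x - g x\<bar> < e" by blast
  have "cmod (complex_of_real (h x) - complex_of_real (g x)) = \<bar>h x - g x\<bar>" for x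
    unfolding of_real_diff[symmetric] by (rule norm_of_real)
  then show ?thesis using g unfolding P_def by (intro bexI[of _ "\<lambda>x. complex_of_real (g x)"]) auto
qed

text \<open>The closed span in L2, stated with squared distances so that
  \<open>norm_add_squared_le\<close> can replace Minkowski's inequality; its factors 2 explain the
  choices \<epsilon> / 4 below.\<close>

definition L2_trig_closure :: "real measure \<Rightarrow> real set \<Rightarrow> (real \<Rightarrow> complex) set" where
  "L2_trig_closure M I = {f \<in> L2_functions M.
     \<forall>\<epsilon>>0. \<exists>g\<in>trig_span I. (LINT x|M. (cmod (f x - g x))\<^sup>2) < \<epsilon>}"

lemma norm_add_squared_le: "(cmod (a + b))\<^sup>2 \<le> 2 * (cmod a)\<^sup>2 + 2 * (cmod b)\<^sup>2"
proof -
  have "(cmod (a + b))\<^sup>2 \<le> (cmod a + cmod b)\<^sup>2"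
    by (intro power_mono norm_triangle_ineq) simp
  also have "\<dots> \<le> 2 * (cmod a)\<^sup>2 + 2 * (cmod b)\<^sup>2"
    using sum_squares_bound[of "cmod a" "cmod b"] by (simp add: power2_sum)
  finally show ?thesis .
qed

context real_distribution
begin

lemma L2_add:
  assumes "f \<in> L2_functions M" "g \<in> L2_functions M"
  shows "(\<lambda>x. f x + g x) \<in> L2_functions M"
    and "(LINT x|M. (cmod (f x + g x))\<^sup>2) \<le> 2 * (LINT x|M. (cmod (f x))\<^sup>2) + 2 * (LINT x|M. (cmod (g x))\<^sup>2)"
proof -
  have [measurable]: "f \<in> borel_measurable M" "g \<in> borel_measurable M"
    and i: "integrable M (\<lambda>x. (cmod (f x))\<^sup>2)" "integrable M (\<lambda>x. (cmod (g x))\<^sup>2)"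
    using assms unfolding L2_functions_def by auto
  have i2: "integrable M (\<lambda>x. 2 * (cmod (f x))\<^sup>2 + 2 * (cmod (g x))\<^sup>2)" using i by simp
  have i3: "integrable M (\<lambda>x. (cmod (f x + g x))\<^sup>2)"
    by (rule Bochner_Integration.integrable_bound[OF i2]) (auto simp: norm_add_squared_le)
  then show "(\<lambda>x. f x + g x) \<in> L2_functions M" unfolding L2_functions_def by simp
  have "(LINT x|M. (cmod (f x + g x))\<^sup>2) \<le> (LINT x|M. 2 * (cmod (f x))\<^sup>2 + 2 * (cmod (g x))\<^sup>2)"
    using i3 i2 by (intro integral_mono norm_add_squared_le)
  then show "(LINT x|M. (cmod (f x + g x))\<^sup>2) \<le> 2 * (LINT x|M. (cmod (f x))\<^sup>2) + 2 * (LINT x|M. (cmod (g x))\<^sup>2)"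
    using i by simp
qed

lemma L2_scale:
  assumes "f \<in> L2_functions M"
  shows "(\<lambda>x. a * f x) \<in> L2_functions M"
    and "(LINT x|M. (cmod (a * f x))\<^sup>2) = (cmod a)\<^sup>2 * (LINT x|M. (cmod (f x))\<^sup>2)"
  using assms unfolding L2_functions_def by (auto simp: norm_mult power_mult_distrib)

lemma L2_diff:
  assumes "f \<in> L2_functions M" "g \<in> L2_functions M"
  shows "(\<lambda>x. f x - g x) \<in> L2_functions M"
  using L2_add(1)[OF assms(1) L2_scale(1)[OF assms(2), of "- 1"]] by simp

lemma bounded_in_L2:
  assumes "f \<in> borel_measurable borel" "\<And>x. cmod (f x) \<le> B"
  shows "f \<in> L2_functions M"
proof -
  have f [measurable]: "f \<in> borel_measurable M" using assms(1) by simp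
  have "integrable M (\<lambda>x. (cmod (f x))\<^sup>2)"
    by (rule integrable_const_bound[where B="B\<^sup>2"]) (auto intro!: power_mono assms(2))
  then show ?thesis unfolding L2_functions_def by simp
qed

lemma trig_span_in_L2:
  assumes "f \<in> trig_span I"
  shows "f \<in> L2_functions M"
proof -
  obtain B where B: "\<And>x. cmod (f x) \<le> B" using bounded_trig_span[OF assms] by blast
  have "f \<in> borel_measurable borel"
    by (intro borel_measurable_continuous_onI continuous_on_trig_span[OF assms])
  then show ?thesis using B by (rule bounded_in_L2)
qed

lemma L2_trig_closureI_approx:
  assumes f: "f \<in> L2_functions M"
    and a: "\<And>\<epsilon>. \<epsilon> > 0 \<Longrightarrow> \<exists>g\<in>L2_trig_closure M I. (LINT x|M. (cmod (f x - g x))\<^sup>2) < \<epsilon>"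
  shows "f \<in> L2_trig_closure M I"
  unfolding L2_trig_closure_def
proof (intro CollectI conjI allI impI f)
  fix \<epsilon> :: real assume "\<epsilon> > 0"
  then have e4: "\<epsilon> / 4 > 0" by simp
  then obtain g where g: "g \<in> L2_trig_closure M I" "(LINT x|M. (cmod (f x - g x))\<^sup>2) < \<epsilon> / 4"
    using a by blast
  then obtain h where h: "h \<in> trig_span I" "(LINT x|M. (cmod (g x - h x))\<^sup>2) < \<epsilon> / 4"
    using e4 unfolding L2_trig_closure_def by blast
  have "g \<in> L2_functions M" using g unfolding L2_trig_closure_def by simp
  then have "(LINT x|M. (cmod ((f x - g x) + (g x - h x)))\<^sup>2)
      \<le> 2 * (LINT x|M. (cmod (f x - g x))\<^sup>2) + 2 * (LINT x|M. (cmod (g x - h x))\<^sup>2)"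
    using f trig_span_in_L2[OF h(1)] by (intro L2_add(2) L2_diff)
  also have "\<dots> < \<epsilon>" using g(2) h(2) by linarith
  finally show "\<exists>g\<in>trig_span I. (LINT x|M. (cmod (f x - g x))\<^sup>2) < \<epsilon>" using h(1) by auto
qed

lemma trig_span_subset_closure: "trig_span I \<subseteq> L2_trig_closure M I"
proof
  fix f assume f: "f \<in> trig_span I"
  then show "f \<in> L2_trig_closure M I"
    unfolding L2_trig_closure_def using trig_span_in_L2[OF f] by (auto intro!: bexI[of _ f])
qed

lemma L2_trig_closure_add:
  assumes "f \<in> L2_trig_closure M I" "g \<in> L2_trig_closure M I"
  shows "(\<lambda>x. f x + g x) \<in> L2_trig_closure M I"
  unfolding L2_trig_closure_def
proof (intro CollectI conjI allI impI)
  have L: "f \<in> L2_functions M" "g \<in> L2_functions M" using assms unfolding L2_trig_closure_def by auto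
  then show "(\<lambda>x. f x + g x) \<in> L2_functions M" by (rule L2_add)
  fix \<epsilon> :: real assume "\<epsilon> > 0"
  then have "\<epsilon> / 4 > 0" by simp
  then obtain f' g' where h: "f' \<in> trig_span I" "(LINT x|M. (cmod (f x - f' x))\<^sup>2) < \<epsilon> / 4"
      "g' \<in> trig_span I" "(LINT x|M. (cmod (g x - g' x))\<^sup>2) < \<epsilon> / 4"
    using assms unfolding L2_trig_closure_def by blast
  have "(LINT x|M. (cmod ((f x - f' x) + (g x - g' x)))\<^sup>2)
      \<le> 2 * (LINT x|M. (cmod (f x - f' x))\<^sup>2) + 2 * (LINT x|M. (cmod (g x - g' x))\<^sup>2)"
    using L h(1,3) trig_span_in_L2 by (intro L2_add(2) L2_diff)
  also have "\<dots> < \<epsilon>" using h(2,4) by linarith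
  finally have "(LINT x|M. (cmod (f x + g x - (f' x + g' x)))\<^sup>2) < \<epsilon>"
    by (simp add: algebra_simps)
  then show "\<exists>h\<in>trig_span I. (LINT x|M. (cmod (f x + g x - h x))\<^sup>2) < \<epsilon>"
    by (rule bexI[OF _ trig_span_add[OF h(1,3)]])
qed

lemma L2_trig_closure_scale:
  assumes "f \<in> L2_trig_closure M I"
  shows "(\<lambda>x. a * f x) \<in> L2_trig_closure M I"
  unfolding L2_trig_closure_def
proof (intro CollectI conjI allI impI)
  have L: "f \<in> L2_functions M" using assms unfolding L2_trig_closure_def by auto
  then show "(\<lambda>x. a * f x) \<in> L2_functions M" by (rule L2_scale)
  fix \<epsilon> :: real assume "\<epsilon> > 0"
  define A where "A = (cmod a)\<^sup>2 + 1"
  have A: "A > 0" unfolding A_def by (simp add: add_nonneg_pos)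
  then have "\<epsilon> / A > 0" using \<open>\<epsilon> > 0\<close> by simp
  then obtain f' where h: "f' \<in> trig_span I" "(LINT x|M. (cmod (f x - f' x))\<^sup>2) < \<epsilon> / A"
    using assms unfolding L2_trig_closure_def by blast
  have "(LINT x|M. (cmod (a * (f x - f' x)))\<^sup>2) = (cmod a)\<^sup>2 * (LINT x|M. (cmod (f x - f' x))\<^sup>2)"
    by (rule L2_scale(2)) (intro L2_diff L trig_span_in_L2[OF h(1)])
  also have "\<dots> \<le> A * (LINT x|M. (cmod (f x - f' x))\<^sup>2)"
    unfolding A_def by (intro mult_right_mono) auto
  also have "\<dots> < \<epsilon>" using h(2) A by (simp add: field_simps)
  finally have "(LINT x|M. (cmod (a * f x - a * f' x))\<^sup>2) < \<epsilon>" by (simp add: right_diff_distrib)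
  then show "\<exists>h\<in>trig_span I. (LINT x|M. (cmod (a * f x - h x))\<^sup>2) < \<epsilon>"
    by (rule bexI[OF _ trig_span_scale[OF h(1)]])
qed

lemma L2_trig_closure_sum:
  assumes "finite A" "\<And>i. i \<in> A \<Longrightarrow> f i \<in> L2_trig_closure M I"
  shows "(\<lambda>x. \<Sum>i\<in>A. c i * f i x) \<in> L2_trig_closure M I"
  using assms
proof (induction A rule: finite_induct)
  case empty
  show ?case using trig_span_subset_closure trig_span.zero by auto
next
  case (insert i A)
  then have "(\<lambda>x. c i * f i x + (\<Sum>i\<in>A. c i * f i x)) \<in> L2_trig_closure M I"
    by (intro L2_trig_closure_add L2_trig_closure_scale) auto
  then show ?case using insert.hyps by simp
qed

text \<open>Dominated convergence with bound 4 |w|^2. Indicators of closed sets, disjoint unions and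
  general L2 functions all enter the closure as such pointwise limits.\<close>

lemma L2_trig_closure_dominated_limit:
  assumes s: "\<And>n. s n \<in> L2_trig_closure M I" and f: "f \<in> L2_functions M"
    and w: "w \<in> L2_functions M" "\<And>n x. cmod (s n x) \<le> cmod (w x)" "\<And>x. cmod (f x) \<le> cmod (w x)"
    and lim: "\<And>x. (\<lambda>n. s n x) \<longlonglongrightarrow> f x"
  shows "f \<in> L2_trig_closure M I"
proof (rule L2_trig_closureI_approx[OF f])
  fix \<epsilon> :: real assume "\<epsilon> > 0"
  have [measurable]: "f \<in> borel_measurable M" "s n \<in> borel_measurable M" for n
    using f s[of n] unfolding L2_trig_closure_def L2_functions_def by auto
  have bd: "norm ((cmod (f x - s n x))\<^sup>2) \<le> 4 * (cmod (w x))\<^sup>2" for n x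
  proof -
    have "cmod (f x - s n x) \<le> 2 * cmod (w x)"
      using norm_triangle_ineq4[of "f x" "s n x"] w(2)[of n x] w(3)[of x] by linarith
    then have "(cmod (f x - s n x))\<^sup>2 \<le> (2 * cmod (w x))\<^sup>2" by (intro power_mono) auto
    then show ?thesis by (simp add: power_mult_distrib)
  qed
  have "(\<lambda>n. LINT x|M. (cmod (f x - s n x))\<^sup>2) \<longlonglongrightarrow> (LINT x|M. (0::real))"
  proof (rule integral_dominated_convergence[where w="\<lambda>x. 4 * (cmod (w x))\<^sup>2"])
    show "integrable M (\<lambda>x. 4 * (cmod (w x))\<^sup>2)" using w(1) unfolding L2_functions_def by simp
    show "AE x in M. (\<lambda>n. (cmod (f x - s n x))\<^sup>2) \<longlonglongrightarrow> 0"
    proof (rule AE_I2)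
      fix x
      have "(\<lambda>n. (cmod (f x - s n x))\<^sup>2) \<longlonglongrightarrow> (cmod (f x - f x))\<^sup>2"
        by (intro tendsto_intros lim)
      then show "(\<lambda>n. (cmod (f x - s n x))\<^sup>2) \<longlonglongrightarrow> 0" by simp
    qed
    show "AE x in M. norm ((cmod (f x - s n x))\<^sup>2) \<le> 4 * (cmod (w x))\<^sup>2" for n
      by (intro AE_I2 bd)
  qed measurable
  then have "\<forall>\<^sub>F n in sequentially. (LINT x|M. (cmod (f x - s n x))\<^sup>2) < \<epsilon>"
    using \<open>\<epsilon> > 0\<close> by (intro order_tendstoD) auto
  then obtain n where "(LINT x|M. (cmod (f x - s n x))\<^sup>2) < \<epsilon>"
    unfolding eventually_sequentially by blast
  then show "\<exists>g\<in>L2_trig_closure M I. (LINT x|M. (cmod (f x - g x))\<^sup>2) < \<epsilon>" using s by blast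
qed

text \<open>Uniform approximation is available on \<open>K\<close> only; the complement of
  \<open>K\<close> is a null set, so the integral does not see it.\<close>

lemma continuous_in_trig_closure:
  fixes h :: "real \<Rightarrow> real"
  assumes K: "compact K" "measure M K = 1"
    and h: "continuous_on UNIV h" "\<And>x. \<bar>h x\<bar> \<le> B"
  shows "(\<lambda>x. complex_of_real (h x)) \<in> L2_trig_closure M UNIV"
  unfolding L2_trig_closure_def
proof (intro CollectI conjI allI impI)
  have "(\<lambda>x. complex_of_real (h x)) \<in> borel_measurable borel"
    using h(1) by (intro borel_measurable_continuous_onI continuous_intros)
  then show L: "(\<lambda>x. complex_of_real (h x)) \<in> L2_functions M"
    by (rule bounded_in_L2[where B=B]) (simp add: h(2))
  fix \<epsilon> :: real assume "\<epsilon> > 0"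
  then have s: "sqrt (\<epsilon> / 2) > 0" by simp
  have "continuous_on K h" using h(1) continuous_on_subset by blast
  then obtain g where g: "g \<in> trig_span UNIV" "\<And>x. x \<in> K \<Longrightarrow> cmod (complex_of_real (h x) - g x) < sqrt (\<epsilon> / 2)"
    using trig_span_approximates_continuous[OF K(1) _ s] by blast
  have "AE x in M. x \<in> K"
    using K prob_Collect_eq_1[of "\<lambda>x. x \<in> K"] by (simp add: compact_imp_closed borel_closed)
  then have "AE x in M. (cmod (complex_of_real (h x) - g x))\<^sup>2 \<le> \<epsilon> / 2"
  proof eventually_elim
    case (elim x)
    have "(cmod (complex_of_real (h x) - g x))\<^sup>2 \<le> (sqrt (\<epsilon> / 2))\<^sup>2"
      using g(2)[OF elim] by (intro power_mono) auto
    then show ?case using \<open>\<epsilon> > 0\<close> by simp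
  qed
  moreover have "integrable M (\<lambda>x. (cmod (complex_of_real (h x) - g x))\<^sup>2)"
    using L2_diff[OF L trig_span_in_L2[OF g(1)]] unfolding L2_functions_def by simp
  ultimately have "(LINT x|M. (cmod (complex_of_real (h x) - g x))\<^sup>2) \<le> \<epsilon> / 2"
    by (intro integral_le_const) auto
  then have "(LINT x|M. (cmod (complex_of_real (h x) - g x))\<^sup>2) < \<epsilon>" using \<open>\<epsilon> > 0\<close> by linarith
  then show "\<exists>g\<in>trig_span UNIV. (LINT x|M. (cmod (complex_of_real (h x) - g x))\<^sup>2) < \<epsilon>"
    using g(1) by blast
qed

lemma const_in_trig_closure: "(\<lambda>x. c) \<in> L2_trig_closure M UNIV"
  using trig_span_subset_closure trig_span_const by blast

lemma indicator_in_L2: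
  assumes "A \<in> sets borel"
  shows "indicator A \<in> L2_functions M"
  using assms by (intro bounded_in_L2[where B=1]) (auto split: split_indicator)

lemma indicator_closed_in_trig_closure:
  assumes K: "compact K" "measure M K = 1" and S: "closed S"
  shows "indicator S \<in> L2_trig_closure M UNIV"
\<comment> \<open>\<open>infdist\<close> to the empty set is 0 by convention, so the cut-off
  functions \<open>h n\<close> would be constantly 1 there.\<close>
proof (cases "S = {}")
  case True
  have "(indicator {} :: real \<Rightarrow> complex) = (\<lambda>x. 0)" by (rule ext) simp
  then show ?thesis using True const_in_trig_closure[of 0] by simp
next
  case False
  define h where "h n x = max 0 (1 - real n * infdist x S)" for n and x :: real
  have h: "\<bar>h n x\<bar> \<le> 1" for n x unfolding h_def by (auto simp: infdist_nonneg)
  show ?thesis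
  proof (rule L2_trig_closure_dominated_limit[where w="\<lambda>x. 1" and s="\<lambda>n x. complex_of_real (h n x)"])
    show "(\<lambda>x. complex_of_real (h n x)) \<in> L2_trig_closure M UNIV" for n
      by (rule continuous_in_trig_closure[OF K _ h]) (unfold h_def, intro continuous_intros)
    show "indicator S \<in> L2_functions M" using S by (intro indicator_in_L2 borel_closed)
    show "(\<lambda>x. 1) \<in> L2_functions M" by (rule bounded_in_L2[where B=1]) auto
    show "cmod (indicator S x) \<le> cmod 1" for x by (auto split: split_indicator)
    show "cmod (complex_of_real (h n x)) \<le> cmod 1" for n x using h by simp
    fix x
    have "(\<lambda>n. h n x) \<longlonglongrightarrow> indicator S x"
    proof (cases "x \<in> S")
      case True
      then show ?thesis unfolding h_def by simp
    next
      case False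
      then have d: "infdist x S > 0"
        using S \<open>S \<noteq> {}\<close> in_closed_iff_infdist_zero[of S x] infdist_nonneg[of x S] by force
      then obtain n0 where n0: "real n0 * infdist x S > 1" using reals_Archimedean3 by blast
      have "h n x = 0" if "n \<ge> n0" for n
      proof -
        have "real n0 * infdist x S \<le> real n * infdist x S" using that d by (intro mult_right_mono) auto
        then show ?thesis using n0 unfolding h_def by simp
      qed
      then have "\<forall>\<^sub>F n in sequentially. h n x = 0" using eventually_sequentially by blast
      then have "(\<lambda>n. h n x) \<longlonglongrightarrow> 0" by (rule tendsto_eventually)
      then show ?thesis using False by simp
    qed
    then have "(\<lambda>n. complex_of_real (h n x)) \<longlonglongrightarrow> complex_of_real (indicator S x)"
      by (rule tendsto_of_real)
    then show "(\<lambda>n. complex_of_real (h n x)) \<longlonglongrightarrow> indicator S x"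
      by (simp add: of_real_indicator)
  qed
qed

text \<open>A Dynkin-system argument: closed sets are stable under intersection and generate the
  Borel sets, and the closure admits complements and disjoint unions.\<close>

lemma indicator_in_trig_closure:
  assumes K: "compact K" "measure M K = 1" and A: "A \<in> sets borel"
  shows "indicator A \<in> L2_trig_closure M UNIV"
proof -
  have "Int_stable (Collect (closed :: real set \<Rightarrow> bool))" by (auto simp: Int_stable_def)
  moreover have "Collect closed \<subseteq> Pow (UNIV :: real set)" by simp
  moreover have "A \<in> sigma_sets UNIV (Collect closed)"
    using A unfolding borel_eq_closed by simp
  ultimately show ?thesis
  proof (induction rule: sigma_sets_induct_disjoint)
    case (basic A)
    then show ?case using indicator_closed_in_trig_closure[OF K] by simp
  next
    case empty
    have "(indicator {} :: real \<Rightarrow> complex) = (\<lambda>x. 0)" by (rule ext) simp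
    then show ?case using const_in_trig_closure[of 0] by simp
  next
    case (compl A)
    have "(\<lambda>x. 1 + (- 1) * indicator A x) \<in> L2_trig_closure M UNIV"
      by (intro L2_trig_closure_add L2_trig_closure_scale const_in_trig_closure compl.IH)
    moreover have "(\<lambda>x. 1 + (- 1) * indicator A x) = (indicator (UNIV - A) :: real \<Rightarrow> complex)"
      by (auto split: split_indicator)
    ultimately show ?case by simp
  next
    case (union A)
    have bor: "A i \<in> sets borel" for i using union(2) unfolding borel_eq_closed by auto
    show ?case
    proof (rule L2_trig_closure_dominated_limit[where w="\<lambda>x. 1" and s="\<lambda>n. indicator (\<Union>i<n. A i)"])
      show "indicator (\<Union>i<n. A i) \<in> L2_trig_closure M UNIV" for n
      proof -
        have "(\<lambda>x. \<Sum>i<n. 1 * indicator (A i) x) \<in> L2_trig_closure M UNIV"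
          by (intro L2_trig_closure_sum union.IH) auto
        moreover have "(indicator (\<Union>i<n. A i) :: real \<Rightarrow> complex) = (\<lambda>x. \<Sum>i<n. 1 * indicator (A i) x)"
          using union(1) disjoint_family_on_mono[of "{..<n}" UNIV A]
          by (auto simp: indicator_UN_disjoint)
        ultimately show ?thesis by simp
      qed
      show "indicator (\<Union>i. A i) \<in> L2_functions M" using bor by (intro indicator_in_L2 sets.countable_UN') auto
      show "(\<lambda>x. 1) \<in> L2_functions M" by (rule bounded_in_L2[where B=1]) auto
      show "cmod (indicator (\<Union>i<n. A i) x) \<le> cmod 1" for n x by (auto split: split_indicator)
      show "cmod (indicator (\<Union>i. A i) x) \<le> cmod 1" for x by (auto split: split_indicator)
      show "(\<lambda>n. indicator (\<Union>i<n. A i) x :: complex) \<longlonglongrightarrow> indicator (\<Union>i. A i) x" for x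
        by (rule LIMSEQ_indicator_UN)
    qed
  qed
qed

lemma L2_trig_closure_UNIV:
  assumes K: "compact K" "measure M K = 1" and f: "f \<in> L2_functions M"
  shows "f \<in> L2_trig_closure M UNIV"
proof -
  have fm: "f \<in> borel_measurable M" using f unfolding L2_functions_def by simp
  from borel_measurable_implies_sequence_metric[OF fm, of 0]
  obtain s where s: "\<And>i. simple_function M (s i)" "\<And>x. (\<lambda>i. s i x) \<longlonglongrightarrow> f x"
    "\<And>i x. cmod (s i x) \<le> 2 * cmod (f x)" by auto
  show ?thesis
  proof (rule L2_trig_closure_dominated_limit[where w="\<lambda>x. 2 * f x" and s=s])
    show "s n \<in> L2_trig_closure M UNIV" for n
    proof -
      have fin: "finite (s n ` UNIV)" using simple_functionD(1)[OF s(1)] by simp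
      have bor: "s n -` {y} \<in> sets borel" for y using simple_functionD(2)[OF s(1)[of n], of "{y}"] by simp
      have mem: "(\<lambda>x. \<Sum>y\<in>s n ` UNIV. y * indicator (s n -` {y}) x) \<in> L2_trig_closure M UNIV"
        using fin bor by (intro L2_trig_closure_sum indicator_in_trig_closure[OF K])
      have "s n x = (\<Sum>y\<in>s n ` UNIV. y * indicator (s n -` {y}) x)" for x
      proof -
        have "(\<Sum>y\<in>s n ` UNIV. y * indicator (s n -` {y}) x) = (\<Sum>y\<in>{s n x}. y * indicator (s n -` {y}) x)"
          using fin by (intro sum.mono_neutral_right) (auto split: split_indicator)
        then show ?thesis by simp
      qed
      then have "s n = (\<lambda>x. \<Sum>y\<in>s n ` UNIV. y * indicator (s n -` {y}) x)" by (rule ext)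
      then show ?thesis by (rule ssubst[where P="\<lambda>f. f \<in> L2_trig_closure M UNIV"]) (rule mem)
    qed
    show "(\<lambda>x. 2 * f x) \<in> L2_functions M" by (rule L2_scale[OF f])
    show "cmod (s n x) \<le> cmod (2 * f x)" for n x using s(3) by (simp add: norm_mult)
    show "cmod (f x) \<le> cmod (2 * f x)" for x by (simp add: norm_mult)
  qed (use f s(2) in auto)
qed

text \<open>Reduces completeness of a frequency set to approximating single exponentials.\<close>

lemma L2_trig_closure_trans:
  assumes "\<And>\<xi>. expo \<xi> \<in> L2_trig_closure M I"
  shows "L2_trig_closure M UNIV \<subseteq> L2_trig_closure M I"
proof
  fix f assume f: "f \<in> L2_trig_closure M UNIV"
  show "f \<in> L2_trig_closure M I"
  proof (rule L2_trig_closureI_approx)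
    show "f \<in> L2_functions M" using f unfolding L2_trig_closure_def by simp
    fix \<epsilon> :: real assume "\<epsilon> > 0"
    then obtain g where g: "g \<in> trig_span UNIV" "(LINT x|M. (cmod (f x - g x))\<^sup>2) < \<epsilon>"
      using f unfolding L2_trig_closure_def by blast
    from g(1) have "g \<in> L2_trig_closure M I"
    proof (induction rule: trig_span.induct)
      case zero
      show ?case using trig_span_subset_closure trig_span.zero by blast
    next
      case (step g i c)
      then show ?case using assms by (intro L2_trig_closure_add L2_trig_closure_scale)
    qed
    then show "\<exists>g\<in>L2_trig_closure M I. (LINT x|M. (cmod (f x - g x))\<^sup>2) < \<epsilon>" using g(2) by blast
  qed
qed

end

section \<open>Spectral pairs\<close>

context real_distribution
begin

lemma integrable_expo [simp]: "integrable M (expo l)"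
  by (rule integrable_const_bound[where B=1]) auto

lemma fourier_zero [simp]: "fourier M 0 = 1"
  unfolding fourier_char by (simp add: char_zero)

lemma norm_fourier_le_1: "cmod (fourier M \<xi>) \<le> 1"
  unfolding fourier_char by (rule cmod_char_le_1)

lemma continuous_on_fourier: "continuous_on S (fourier M)"
proof -
  have "isCont (\<lambda>\<xi>. char M (- 2 * pi * \<xi>)) \<xi>" for \<xi>
    by (rule isCont_o2[OF _ isCont_char]) (intro continuous_intros)
  then show ?thesis
    unfolding fourier_char[abs_def] by (intro continuous_at_imp_continuous_on ballI)
qed

lemma cnj_fourier: "cnj (fourier M \<xi>) = fourier M (- \<xi>)"
  unfolding fourier_def by (simp add: cnj_expo flip: Bochner_Integration.integral_cnj)

lemma norm_fourier_minus: "cmod (fourier M (- \<xi>)) = cmod (fourier M \<xi>)"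
  unfolding cnj_fourier[symmetric] by simp

text \<open>Completing the square. The coefficients stay arbitrary because both directions use it:
  the Fourier coefficients make the last sum vanish, and any other choice only increases the
  distance.\<close>

lemma bessel_identity:
  assumes F: "finite F" and orth: "\<And>i j. i \<in> F \<Longrightarrow> j \<in> F \<Longrightarrow> i \<noteq> j \<Longrightarrow> fourier M (i - j) = 0"
  shows "(LINT x|M. (cmod (expo \<xi> x - (\<Sum>i\<in>F. c i * expo i x)))\<^sup>2)
    = 1 - (\<Sum>i\<in>F. (cmod (fourier M (\<xi> - i)))\<^sup>2) + (\<Sum>i\<in>F. (cmod (fourier M (\<xi> - i) - c i))\<^sup>2)"
proof -
  define a where "a i = fourier M (\<xi> - i)" for i
  have ip: "(LINT x|M. expo (i - j) x) = fourier M (i - j)" for i j by (simp add: fourier_def)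
  have pointwise: "complex_of_real ((cmod (expo \<xi> x - (\<Sum>i\<in>F. c i * expo i x)))\<^sup>2)
     = 1 - (\<Sum>i\<in>F. cnj (c i) * expo (\<xi> - i) x) - (\<Sum>i\<in>F. c i * expo (i - \<xi>) x)
       + (\<Sum>i\<in>F. \<Sum>j\<in>F. (c i * cnj (c j)) * expo (i - j) x)" for x
  proof -
    have "complex_of_real ((cmod (expo \<xi> x - (\<Sum>i\<in>F. c i * expo i x)))\<^sup>2)
      = (expo \<xi> x - (\<Sum>i\<in>F. c i * expo i x)) * (cnj (expo \<xi> x) - (\<Sum>i\<in>F. cnj (c i) * cnj (expo i x)))"
      unfolding complex_norm_square by simp
    also have "\<dots> = expo \<xi> x * cnj (expo \<xi> x)
       - (\<Sum>i\<in>F. cnj (c i) * (expo \<xi> x * cnj (expo i x)))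
       - (\<Sum>i\<in>F. c i * (expo i x * cnj (expo \<xi> x)))
       + (\<Sum>i\<in>F. \<Sum>j\<in>F. (c i * cnj (c j)) * (expo i x * cnj (expo j x)))"
      by (simp add: algebra_simps sum_product sum_distrib_left sum_distrib_right) (rule sum.swap)
    finally show ?thesis unfolding expo_mult_cnj by simp
  qed
  have int: "integrable M (\<lambda>x. w * expo l x)" for w l by simp
  have "complex_of_real (LINT x|M. (cmod (expo \<xi> x - (\<Sum>i\<in>F. c i * expo i x)))\<^sup>2)
      = (LINT x|M. complex_of_real ((cmod (expo \<xi> x - (\<Sum>i\<in>F. c i * expo i x)))\<^sup>2))"
    by (rule integral_complex_of_real[symmetric])
  also have "\<dots> = 1 - (\<Sum>i\<in>F. cnj (c i) * a i) - (\<Sum>i\<in>F. c i * cnj (a i))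
       + (\<Sum>i\<in>F. \<Sum>j\<in>F. (c i * cnj (c j)) * fourier M (i - j))"
  proof -
    have "(LINT x|M. expo (i - \<xi>) x) = cnj (a i)" for i
      unfolding a_def cnj_fourier by (simp add: fourier_def)
    moreover have "prob UNIV = 1" using prob_space by simp
    ultimately show ?thesis
      unfolding pointwise
      by (simp add: ip a_def)
  qed
  also have "(\<Sum>i\<in>F. \<Sum>j\<in>F. (c i * cnj (c j)) * fourier M (i - j)) = (\<Sum>i\<in>F. c i * cnj (c i))"
  proof (rule sum.cong[OF refl])
    fix i assume i: "i \<in> F"
    have "(\<Sum>j\<in>F. (c i * cnj (c j)) * fourier M (i - j)) = (\<Sum>j\<in>{i}. (c i * cnj (c j)) * fourier M (i - j))"
      using F i orth by (intro sum.mono_neutral_right) auto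
    then show "(\<Sum>j\<in>F. (c i * cnj (c j)) * fourier M (i - j)) = c i * cnj (c i)" by simp
  qed
  also have "1 - (\<Sum>i\<in>F. cnj (c i) * a i) - (\<Sum>i\<in>F. c i * cnj (a i)) + (\<Sum>i\<in>F. c i * cnj (c i))
      = 1 - (\<Sum>i\<in>F. a i * cnj (a i)) + (\<Sum>i\<in>F. (a i - c i) * cnj (a i - c i))"
    by (simp add: algebra_simps sum.distrib sum_subtractf)
  also have "\<dots> = complex_of_real (1 - (\<Sum>i\<in>F. (cmod (a i))\<^sup>2) + (\<Sum>i\<in>F. (cmod (a i - c i))\<^sup>2))"
    by (simp only: of_real_add of_real_diff of_real_sum of_real_1 complex_norm_square)
  finally show ?thesis unfolding a_def of_real_eq_iff .
qed

lemma expo_in_trig_closure: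
  assumes orth: "\<And>i j. i \<in> \<Lambda> \<Longrightarrow> j \<in> \<Lambda> \<Longrightarrow> i \<noteq> j \<Longrightarrow> fourier M (i - j) = 0"
    and parseval: "\<And>\<epsilon>. \<epsilon> > 0 \<Longrightarrow> \<exists>F. finite F \<and> F \<subseteq> \<Lambda> \<and> (\<Sum>i\<in>F. (cmod (fourier M (\<xi> - i)))\<^sup>2) > 1 - \<epsilon>"
  shows "expo \<xi> \<in> L2_trig_closure M \<Lambda>"
  unfolding L2_trig_closure_def
proof (intro CollectI conjI allI impI)
  show "expo \<xi> \<in> L2_functions M" by (rule bounded_in_L2[where B=1]) auto
  fix \<epsilon> :: real assume "\<epsilon> > 0"
  then obtain F where F: "finite F" "F \<subseteq> \<Lambda>" "(\<Sum>i\<in>F. (cmod (fourier M (\<xi> - i)))\<^sup>2) > 1 - \<epsilon>"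
    using parseval by blast
  have "(LINT x|M. (cmod (expo \<xi> x - (\<Sum>i\<in>F. fourier M (\<xi> - i) * expo i x)))\<^sup>2) < \<epsilon>"
    using bessel_identity[OF F(1), of \<xi> "\<lambda>i. fourier M (\<xi> - i)"] orth F(2,3) by (auto simp: subset_iff)
  then show "\<exists>g\<in>trig_span \<Lambda>. (LINT x|M. (cmod (expo \<xi> x - g x))\<^sup>2) < \<epsilon>"
    using trig_span_sum[OF F(1,2), of "\<lambda>i. fourier M (\<xi> - i)"]
    by (rule bexI[where x="\<lambda>x. \<Sum>i\<in>F. fourier M (\<xi> - i) * expo i x"])
qed

lemma L2_inner_expo: "L2_inner M (expo i) (expo j) = fourier M (i - j)"
  unfolding L2_inner_def expo_mult_cnj fourier_def ..

text \<open>The Jorgensen-Pedersen criterion; Parseval is phrased through finite subsets, which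
  matches the finite combinations in the definition of a basis.\<close>

lemma spectral_pairI:
  assumes K: "compact K" "measure M K = 1" and \<Lambda>: "countable \<Lambda>"
    and orth: "\<And>i j. i \<in> \<Lambda> \<Longrightarrow> j \<in> \<Lambda> \<Longrightarrow> i \<noteq> j \<Longrightarrow> fourier M (i - j) = 0"
    and parseval: "\<And>\<xi> \<epsilon>. \<epsilon> > 0 \<Longrightarrow>
      \<exists>F. finite F \<and> F \<subseteq> \<Lambda> \<and> (\<Sum>i\<in>F. (cmod (fourier M (\<xi> - i)))\<^sup>2) > 1 - \<epsilon>"
  shows "spectral_pair M \<Lambda>"
  unfolding spectral_pair_def L2_orthonormal_basis_def expo_def[symmetric] L2_inner_expo
proof (intro conjI ballI allI impI)
  show "prob_space M" by (rule prob_space_axioms)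
  show "sets M = sets borel" by simp
  show "\<exists>K. compact K \<and> measure M K = 1" using K by blast
  show "countable \<Lambda>" by (rule \<Lambda>)
  show "expo i \<in> L2_functions M" for i by (rule bounded_in_L2[where B=1]) auto
  show "fourier M (i - j) = (if i = j then 1 else 0)" if "i \<in> \<Lambda>" "j \<in> \<Lambda>" for i j
    using orth[OF that] by auto
  fix f \<epsilon> assume f: "f \<in> L2_functions M" and \<epsilon>: "(0::real) < \<epsilon>"
  have "expo \<xi> \<in> L2_trig_closure M \<Lambda>" for \<xi>
    by (rule expo_in_trig_closure[OF orth parseval])
  then have "f \<in> L2_trig_closure M \<Lambda>"
    by (rule subsetD[OF L2_trig_closure_trans L2_trig_closure_UNIV[OF K f]])
  moreover have "\<epsilon>\<^sup>2 > 0" using \<epsilon> by simp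
  ultimately obtain g where g: "g \<in> trig_span \<Lambda>" "(LINT x|M. (cmod (f x - g x))\<^sup>2) < \<epsilon>\<^sup>2"
    unfolding L2_trig_closure_def by blast
  then obtain F c where F: "finite F" "F \<subseteq> \<Lambda>" "g = (\<lambda>x. \<Sum>i\<in>F. c i * expo i x)"
    using trig_span_representation by blast
  have "L2_norm M (\<lambda>x. f x - (\<Sum>i\<in>F. c i * expo i x)) < \<epsilon>"
    using g(2) \<epsilon> unfolding L2_norm_def F(3) by (intro real_less_lsqrt) auto
  then show "\<exists>F c. finite F \<and> F \<subseteq> \<Lambda> \<and> L2_norm M (\<lambda>x. f x - (\<Sum>i\<in>F. c i * expo i x)) < \<epsilon>"
    using F(1,2) by blast
qed

lemma spectral_pair_parseval:
  assumes "spectral_pair M \<Lambda>" and \<epsilon>: "\<epsilon> > 0"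
  shows "\<exists>F. finite F \<and> F \<subseteq> \<Lambda> \<and> (\<Sum>i\<in>F. (cmod (fourier M (\<xi> - i)))\<^sup>2) > 1 - \<epsilon>"
proof -
  have basis: "L2_orthonormal_basis M expo \<Lambda>"
    using assms(1) unfolding spectral_pair_def expo_def[abs_def] by (elim conjE)
  have orth: "fourier M (i - j) = (if i = j then 1 else 0)" if "i \<in> \<Lambda>" "j \<in> \<Lambda>" for i j
    using basis that unfolding L2_orthonormal_basis_def L2_inner_expo by (elim conjE) (drule (1) bspec)+
  have dense: "\<exists>F c. finite F \<and> F \<subseteq> \<Lambda> \<and> L2_norm M (\<lambda>x. f x - (\<Sum>i\<in>F. c i * expo i x)) < \<epsilon>"
    if "f \<in> L2_functions M" "\<epsilon> > 0" for f \<epsilon>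
    using basis that unfolding L2_orthonormal_basis_def by (elim conjE) (drule (1) bspec, drule spec, erule (1) mp)
  have "expo \<xi> \<in> L2_functions M" by (rule bounded_in_L2[where B=1]) auto
  moreover have "sqrt \<epsilon> > 0" using \<epsilon> by simp
  ultimately obtain F c where F: "finite F" "F \<subseteq> \<Lambda>"
      and n: "L2_norm M (\<lambda>x. expo \<xi> x - (\<Sum>i\<in>F. c i * expo i x)) < sqrt \<epsilon>"
    using dense[of "expo \<xi>" "sqrt \<epsilon>"] by blast
  have "(LINT x|M. (cmod (expo \<xi> x - (\<Sum>i\<in>F. c i * expo i x)))\<^sup>2) < \<epsilon>"
    using n unfolding L2_norm_def by (simp only: real_sqrt_less_iff)
  moreover have "fourier M (i - j) = 0" if "i \<in> F" "j \<in> F" "i \<noteq> j" for i j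
    using orth[of i j] F(2) that by auto
  ultimately have "1 - (\<Sum>i\<in>F. (cmod (fourier M (\<xi> - i)))\<^sup>2)
      + (\<Sum>i\<in>F. (cmod (fourier M (\<xi> - i) - c i))\<^sup>2) < \<epsilon>"
    using bessel_identity[OF F(1), of \<xi> c] by simp
  moreover have "(\<Sum>i\<in>F. (cmod (fourier M (\<xi> - i) - c i))\<^sup>2) \<ge> 0" by (intro sum_nonneg) auto
  ultimately have "(\<Sum>i\<in>F. (cmod (fourier M (\<xi> - i)))\<^sup>2) > 1 - \<epsilon>" by linarith
  then show ?thesis using F by blast
qed

end

section \<open>The orbit criterion\<close>

text \<open>The truncations of the spectrum, over the integers. A new digit enters at the low end,
  which is the form in which the refinement equation peels it off again.\<close>

primrec radix_sums :: "nat \<Rightarrow> nat \<Rightarrow> nat \<Rightarrow> int set" where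
  "radix_sums N b 0 = {0}"
| "radix_sums N b (Suc n) = (\<lambda>(c, l). c + int b * l) ` (centered_digits N \<times> radix_sums N b n)"

lemma finite_radix_sums [simp]: "finite (radix_sums N b n)"
  by (induction n) auto

text \<open>0 is a digit, so shorter expansions can be padded.\<close>

lemma radix_sums_mono:
  assumes "N \<ge> 1" "m \<le> n"
  shows "radix_sums N b m \<subseteq> radix_sums N b n"
proof -
  have "radix_sums N b n \<subseteq> radix_sums N b (Suc n)" for n
  proof (induction n)
    case 0
    have "(0, 0) \<in> centered_digits N \<times> radix_sums N b 0" using assms(1) by simp
    then have "(\<lambda>(c, l). c + int b * l) (0, 0) \<in> radix_sums N b (Suc 0)"
      unfolding radix_sums.simps(2) by (rule imageI)
    then show ?case by simp
  next
    case (Suc n)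
    then show ?case
      unfolding radix_sums.simps(2)[of N b "Suc n"] by (subst radix_sums.simps(2)) (intro image_mono Sigma_mono order_refl)
  qed
  then show ?thesis using assms(2) by (rule lift_Suc_mono_le)
qed

lemma inj_on_radix_step:
  assumes "N \<le> b" "b > 0"
  shows "inj_on (\<lambda>(c, l). c + int b * l) (centered_digits N \<times> A)"
proof (rule inj_onI, clarify)
  fix c l c' l'
  assume c: "c \<in> centered_digits N" "c' \<in> centered_digits N" and eq: "c + int b * l = c' + int b * l'"
  have "c - c' = int b * (l' - l)" using eq by (simp add: algebra_simps)
  moreover have "\<bar>c - c'\<bar> < int b" using c assms(1) unfolding centered_digits_def by auto
  ultimately have l: "l' - l = 0" using dvd_imp_le_int[of "c - c'" "int b"] by fastforce
  then show "c = c' \<and> l = l'" using eq by simp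
qed

lemma radix_expansions_eq:
  assumes C: "C = real_of_int ` centered_digits N" and N: "N \<ge> 1"
  shows "radix_expansions (real b) C = real_of_int ` (\<Union>n. radix_sums N b n)"
proof (intro equalityI subsetI)
  fix x assume "x \<in> radix_expansions (real b) C"
  then obtain n c where x: "x = (\<Sum>k\<le>n. real b ^ k * c k)" "\<forall>k\<le>n. c k \<in> C"
    unfolding radix_expansions_def by blast
  \<comment> \<open>Indices k <= n mean n + 1 digits, hence level \<open>Suc n\<close>.\<close>
  have "(\<Sum>k\<le>n. real b ^ k * c k) \<in> real_of_int ` radix_sums N b (Suc n)"
    using x(2)
  proof (induction n arbitrary: c)
    case 0
    then obtain a where a: "a \<in> centered_digits N" "c 0 = real_of_int a" using C by auto
    have "(\<lambda>(c, l). c + int b * l) (a, 0) \<in> radix_sums N b (Suc 0)"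
      unfolding radix_sums.simps using a(1) by (intro imageI) simp
    then show ?case using a(2) by simp
  next
    case (Suc n)
    obtain a where a: "a \<in> centered_digits N" "c 0 = real_of_int a" using C Suc.prems by auto
    have "(\<Sum>k\<le>n. real b ^ k * c (Suc k)) \<in> real_of_int ` radix_sums N b (Suc n)"
      using Suc.prems by (intro Suc.IH) auto
    then obtain l where l: "l \<in> radix_sums N b (Suc n)" "(\<Sum>k\<le>n. real b ^ k * c (Suc k)) = real_of_int l"
      by blast
    have "(\<Sum>k\<le>Suc n. real b ^ k * c k) = c 0 + (\<Sum>k\<le>n. real b ^ Suc k * c (Suc k))"
      by (subst sum.atMost_Suc_shift) simp
    also have "(\<Sum>k\<le>n. real b ^ Suc k * c (Suc k)) = real b * (\<Sum>k\<le>n. real b ^ k * c (Suc k))"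
      by (simp add: sum_distrib_left mult.assoc)
    finally have eq: "(\<Sum>k\<le>Suc n. real b ^ k * c k) = real_of_int (a + int b * l)"
      using a(2) l(2) by simp
    have "(\<lambda>(c, l). c + int b * l) (a, l) \<in> radix_sums N b (Suc (Suc n))"
      unfolding radix_sums.simps(2)[of N b "Suc n"] using a(1) l(1) by (intro imageI) simp
    then show ?case unfolding eq by (intro imageI) simp
  qed
  then show "x \<in> real_of_int ` (\<Union>n. radix_sums N b n)" unfolding x(1) by blast
next
  fix x assume "x \<in> real_of_int ` (\<Union>n. radix_sums N b n)"
  then obtain n l where x: "x = real_of_int l" "l \<in> radix_sums N b n" by blast
  have "\<exists>m c. real_of_int l = (\<Sum>k\<le>m. real b ^ k * c k) \<and> (\<forall>k\<le>m. c k \<in> C)"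
    using x(2)
  proof (induction n arbitrary: l)
    case 0
    \<comment> \<open>\<open>radix_expansions\<close> has at least one digit, so the empty sum at
      level 0 is represented by the single digit 0.\<close>
    have "0 \<in> C" unfolding C using N by (intro image_eqI[of _ _ 0]) auto
    then show ?case using 0 by (intro exI[of _ 0] exI[of _ "\<lambda>_. 0"]) auto
  next
    case (Suc n)
    then obtain a l' where a: "a \<in> centered_digits N" "l' \<in> radix_sums N b n" "l = a + int b * l'"
      by auto
    obtain m c where c: "real_of_int l' = (\<Sum>k\<le>m. real b ^ k * c k)" "\<forall>k\<le>m. c k \<in> C"
      using Suc.IH[OF a(2)] by blast
    define c' where "c' k = (case k of 0 \<Rightarrow> real_of_int a | Suc j \<Rightarrow> c j)" for k
    have "(\<Sum>k\<le>Suc m. real b ^ k * c' k) = real_of_int a + (\<Sum>k\<le>m. real b ^ Suc k * c k)"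
      by (subst sum.atMost_Suc_shift) (simp add: c'_def)
    also have "(\<Sum>k\<le>m. real b ^ Suc k * c k) = real b * real_of_int l'"
      unfolding c(1) by (simp add: sum_distrib_left mult.assoc)
    finally have "real_of_int l = (\<Sum>k\<le>Suc m. real b ^ k * c' k)" using a(3) by simp
    moreover have "\<forall>k\<le>Suc m. c' k \<in> C"
      using c(2) a(1) C by (auto simp: c'_def split: nat.split)
    ultimately show ?case by blast
  qed
  then show "x \<in> radix_expansions (real b) C"
    unfolding radix_expansions_def x(1) by blast
qed

text \<open>\<open>M\<close> enters through its self-similarity, and \<open>t\<close> is a
  parameter, so that the criterion can be used for one measure with different exponents.\<close>

locale cantor_pair = real_distribution M for M :: "real measure" +
  fixes N q b t :: nat
  assumes N: "N \<ge> 2" and q: "q \<ge> 2" and b: "b = q * N" and t: "t > 0" "coprime t b"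
    and self_similar: "is_self_similar_measure (real b) ((\<lambda>d. real q * d) ` real ` {0..N - 1}) M"
begin

lemma b_ge: "b \<ge> 2 * N" "b \<ge> 4" "b > 0"
proof -
  show "b \<ge> 2 * N" unfolding b using q by (intro mult_right_mono) auto
  then show "b \<ge> 4" "b > 0" using N by auto
qed

lemma coprime_t_N: "coprime t N"
  using t(2) unfolding b by simp

lemma fourier_refinement: "fourier M \<xi> = mask N (\<xi> / real N) * fourier M (\<xi> / real b)"
proof -
  let ?B = "(\<lambda>d. real q * d) ` real ` {0..N - 1}"
  have set: "{0..N - 1} = {..<N}" using N by auto
  have B: "?B = (\<lambda>d. real q * real d) ` {..<N}" unfolding set by (simp add: image_image)
  have inj: "inj_on (\<lambda>d. real q * real d) {..<N}" using q by (auto simp: inj_on_def)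
  have "(\<Sum>a\<in>?B. expo (\<xi> / real b) a) = (\<Sum>d<N. expo (\<xi> / real b) (real q * real d))"
    unfolding B by (simp add: sum.reindex[OF inj])
  also have "\<dots> = (\<Sum>d<N. expo (\<xi> / real N) (real d))"
  proof (rule sum.cong[OF refl])
    fix d
    have "\<xi> / real b * real q = \<xi> / real N" unfolding b using q by simp
    then show "expo (\<xi> / real b) (real q * real d) = expo (\<xi> / real N) (real d)"
      using expo_mult_swap[of "\<xi> / real b" "real q" "real d"] by simp
  qed
  finally have "(\<Sum>a\<in>?B. expo (\<xi> / real b) a) / card ?B = mask N (\<xi> / real N)"
    unfolding mask_def B by (simp add: card_image[OF inj])
  moreover have "finite ?B" "?B \<noteq> {}" by auto
  ultimately show ?thesis using fourier_self_similar[OF self_similar, of \<xi>] by simp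
qed

text \<open>Transition probabilities of a random walk that moves \<xi> to
  \<open>branch \<xi> c\<close>; the energies obey the associated transfer operator.\<close>

definition weight :: "real \<Rightarrow> int \<Rightarrow> real" where
  "weight \<xi> c = (cmod (mask N ((\<xi> + real t * of_int c) / real N)))\<^sup>2"

definition branch :: "real \<Rightarrow> int \<Rightarrow> real" where
  "branch \<xi> c = (\<xi> + real t * of_int c) / real b"

definition partial_energy :: "nat \<Rightarrow> real \<Rightarrow> real" where
  "partial_energy n \<xi> = (\<Sum>l\<in>radix_sums N b n. (cmod (fourier M (\<xi> + real t * of_int l)))\<^sup>2)"

lemma weight_nonneg: "weight \<xi> c \<ge> 0"
  unfolding weight_def by simp

lemma sum_weight: "(\<Sum>c\<in>centered_digits N. weight \<xi> c) = 1"
  unfolding weight_def using N by (intro sum_mask_squared coprime_t_N) auto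

lemma partial_energy_0: "partial_energy 0 \<xi> = (cmod (fourier M \<xi>))\<^sup>2"
  unfolding partial_energy_def by simp

text \<open>The refinement equation at \<xi> + t (c + b l) gives the mask at (\<xi> + t c)/N + t q
  l, where the integer t q l drops out by periodicity, times the transform at branch \<xi> c + t
  l.\<close>

lemma partial_energy_Suc:
  "partial_energy (Suc n) \<xi> = (\<Sum>c\<in>centered_digits N. weight \<xi> c * partial_energy n (branch \<xi> c))"
proof -
  have summand: "(cmod (fourier M (\<xi> + real t * of_int (c + int b * l))))\<^sup>2
      = weight \<xi> c * (cmod (fourier M (branch \<xi> c + real t * of_int l)))\<^sup>2" for c l
  proof -
    let ?\<eta> = "\<xi> + real t * of_int (c + int b * l)"
    have "?\<eta> / real N = (\<xi> + real t * of_int c) / real N + of_int (int t * int q * l)"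
      using N unfolding b by (simp add: field_simps)
    moreover have "?\<eta> / real b = branch \<xi> c + real t * of_int l"
      using b_ge(3) unfolding branch_def by (simp add: field_simps)
    ultimately have "fourier M ?\<eta>
        = mask N ((\<xi> + real t * of_int c) / real N) * fourier M (branch \<xi> c + real t * of_int l)"
      using fourier_refinement[of ?\<eta>] mask_add_int by metis
    then show ?thesis unfolding weight_def by (simp add: norm_mult power_mult_distrib)
  qed
  have "N \<le> b" using b_ge by simp
  then have inj: "inj_on (\<lambda>(c, l). c + int b * l) (centered_digits N \<times> radix_sums N b n)"
    using b_ge(3) by (rule inj_on_radix_step)
  have "partial_energy (Suc n) \<xi>
      = (\<Sum>(c, l)\<in>centered_digits N \<times> radix_sums N b n. (cmod (fourier M (\<xi> + real t * of_int (c + int b * l))))\<^sup>2)"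
    unfolding partial_energy_def radix_sums.simps(2)
    by (subst sum.reindex[OF inj]) (auto intro!: sum.cong)
  also have "\<dots> = (\<Sum>c\<in>centered_digits N. \<Sum>l\<in>radix_sums N b n. weight \<xi> c * (cmod (fourier M (branch \<xi> c + real t * of_int l)))\<^sup>2)"
    unfolding summand by (rule sum.cartesian_product[symmetric])
  finally show ?thesis unfolding partial_energy_def by (simp only: sum_distrib_left)
qed

lemma partial_energy_mono: "m \<le> n \<Longrightarrow> partial_energy m \<xi> \<le> partial_energy n \<xi>"
  unfolding partial_energy_def using N by (intro sum_mono2 radix_sums_mono) auto

text \<open>The recursion is an average and a single term is at most 1; Bessel's inequality is thus
  available ahead of orthogonality.\<close>

lemma partial_energy_le_1: "partial_energy n \<xi> \<le> 1"
proof (induction n arbitrary: \<xi>)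
  case 0
  show ?case unfolding partial_energy_0 using norm_fourier_le_1[of \<xi>] by (simp add: power_le_one)
next
  case (Suc n)
  have "partial_energy (Suc n) \<xi> \<le> (\<Sum>c\<in>centered_digits N. weight \<xi> c * 1)"
    unfolding partial_energy_Suc by (intro sum_mono mult_left_mono Suc weight_nonneg)
  then show ?case using sum_weight by simp
qed

lemma continuous_on_partial_energy: "continuous_on S (partial_energy n)"
proof -
  have "continuous_on S (\<lambda>\<xi>. fourier M (\<xi> + real t * of_int l))" for l
    by (rule continuous_on_compose2[OF continuous_on_fourier[of UNIV]]) (auto intro!: continuous_intros)
  then show ?thesis unfolding partial_energy_def[abs_def] by (intro continuous_intros)
qed

text \<open>Orthogonality comes for free from the bound on the energy: at \<open>-t l\<close> the term of \<open>l\<close> already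
  contributes \<open>1\<close>.\<close>

lemma fourier_orthogonal:
  assumes "l \<in> radix_sums N b n" "l' \<in> radix_sums N b n" "l \<noteq> l'"
  shows "fourier M (real t * of_int l - real t * of_int l') = 0"
proof -
  have "(\<Sum>k\<in>{l', l}. (cmod (fourier M (- (real t * of_int l') + real t * of_int k)))\<^sup>2)
      \<le> partial_energy n (- (real t * of_int l'))"
    unfolding partial_energy_def using assms by (intro sum_mono2) auto
  also have "\<dots> \<le> 1" by (rule partial_energy_le_1)
  finally have "(cmod (fourier M (- (real t * of_int l') + real t * of_int l)))\<^sup>2 \<le> 0"
    using assms(3) by simp
  then show ?thesis by (simp add: add.commute)
qed

text \<open>The modulus can only grow from \<xi> to \<xi> / b^j, so it is enough to treat a nonzero
  y with |y| < 1, which is no integer; there the mask factor is already below 1.\<close>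

lemma norm_fourier_less_1:
  assumes "\<xi> \<noteq> 0"
  shows "cmod (fourier M \<xi>) < 1"
proof -
  have b1: "real b > 1" using b_ge by simp
  have step: "cmod (fourier M \<xi>) \<le> cmod (fourier M (\<xi> / real b))"
    "cmod (fourier M \<xi>) \<le> cmod (mask N (\<xi> / real N))" for \<xi>
    unfolding fourier_refinement[of \<xi>] norm_mult
    using norm_mask_le norm_fourier_le_1 by (simp_all add: mult_left_le_one_le mult_right_le_one_le)
  have all: "cmod (fourier M \<xi>) \<le> cmod (fourier M (\<xi> / real b ^ j))" for j
  proof (induction j)
    case (Suc j)
    also have "cmod (fourier M (\<xi> / real b ^ j)) \<le> cmod (fourier M (\<xi> / real b ^ j / real b))" by (rule step)
    finally show ?case by (simp add: mult.commute)
  qed simp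
  have "(\<lambda>n. \<bar>\<xi> / real b ^ n\<bar>) \<longlonglongrightarrow> 0"
    using tendsto_scale_down[OF b1] by (intro tendsto_rabs_zero)
  then have "\<forall>\<^sub>F n in sequentially. \<bar>\<xi> / real b ^ n\<bar> < 1" by (rule order_tendstoD) simp
  then obtain j where j: "\<bar>\<xi> / real b ^ j\<bar> < 1" unfolding eventually_sequentially by blast
  define y where "y = \<xi> / real b ^ j"
  have y: "\<bar>y\<bar> < 1" "y \<noteq> 0" using j assms b1 unfolding y_def by auto
  have "y \<notin> \<int>" using y Ints_nonzero_abs_less1 by blast
  have "cmod (mask N (y / real N)) \<noteq> 1"
  proof
    assume 1: "cmod (mask N (y / real N)) = 1"
    \<comment> \<open>The identity with t = 1: if digit 0 took the whole mass, digit 1, admissible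
      as N >= 2, would have mask 0, and y + 1 would be an integer.\<close>
    have "(\<Sum>c\<in>{0, 1}. (cmod (mask N ((y + real 1 * of_int c) / real N)))\<^sup>2)
        \<le> (\<Sum>c\<in>centered_digits N. (cmod (mask N ((y + real 1 * of_int c) / real N)))\<^sup>2)"
    proof (rule sum_mono2)
      show "{0, 1} \<subseteq> centered_digits N" using N by (auto simp: centered_digits_def)
    qed auto
    also have "\<dots> = 1" using N by (intro sum_mask_squared) auto
    finally have "mask N ((y + 1) / real N) = 0" using 1 by simp
    then have "real N * ((y + 1) / real N) \<in> \<int>" using N by (intro mask_eq_0_imp) auto
    then have "y + 1 \<in> \<int>" using N by simp
    then have "y + 1 - 1 \<in> \<int>" by (intro Ints_diff Ints_1)
    then show False using \<open>y \<notin> \<int>\<close> by simp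
  qed
  then have "cmod (mask N (y / real N)) < 1" using norm_mask_le[of N "y / real N"] by simp
  moreover have "cmod (fourier M \<xi>) \<le> cmod (mask N (y / real N))"
    using all[of j] step(2)[of y] unfolding y_def by (rule order.trans)
  ultimately show ?thesis by simp
qed

text \<open>Along an orbit exactly one branch has nonzero weight, so the energy at \<open>x 0\<close> is the single
  value \<open>|fourier M (x n)|\<^sup>2\<close>, which is bounded away from \<open>1\<close>.\<close>

lemma orbit_energy_deficit:
  assumes orb: "digit_orbit N b t x"
  shows "\<exists>\<kappa><1. \<forall>n. partial_energy n (of_int (x 0)) \<le> \<kappa>"
proof -
  have energy: "partial_energy n (of_int (x j)) = (cmod (fourier M (of_int (x (j + n)))))\<^sup>2" for n j
  proof (induction n arbitrary: j)
    case 0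
    then show ?case by (simp add: partial_energy_0)
  next
    case (Suc n)
    obtain c where c: "c \<in> centered_digits N" "int b * x (Suc j) = x j + int t * c"
      using orb unfolding digit_orbit_def by blast
    have num: "of_int (x j) + real t * of_int c = real b * of_int (x (Suc j))"
      using arg_cong[OF c(2), of real_of_int] by simp
    have br: "branch (of_int (x j)) c = of_int (x (Suc j))"
      unfolding branch_def num using b_ge(3) by simp
    \<comment> \<open>(x j + t c)/N = q * x (Suc j) is an integer, where the mask equals 1; as the
      weights sum to 1, all other branches get weight 0.\<close>
    have "weight (of_int (x j)) c = (cmod (mask N (0 + of_int (int q * x (Suc j)))))\<^sup>2"
      unfolding weight_def num using N by (simp add: b)
    also have "\<dots> = (cmod (mask N 0))\<^sup>2" unfolding mask_add_int ..
    also have "\<dots> = 1" using N by (simp add: mask_def)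
    finally have w: "weight (of_int (x j)) c = 1" .
    have "(\<Sum>c'\<in>centered_digits N - {c}. weight (of_int (x j)) c') = 0"
      using sum_weight[of "of_int (x j)"] w c(1) by (simp add: sum.remove[of "centered_digits N" c])
    then have w0: "weight (of_int (x j)) c' = 0" if "c' \<in> centered_digits N - {c}" for c'
      using that weight_nonneg by (subst (asm) sum_nonneg_eq_0_iff) auto
    have "partial_energy (Suc n) (of_int (x j)) = partial_energy n (of_int (x (Suc j)))"
      unfolding partial_energy_Suc using c(1) w w0 br by (simp add: sum.remove[of "centered_digits N" c])
    then show ?case using Suc[of "Suc j"] by simp
  qed
  \<comment> \<open>The contraction keeps the orbit in [-R, R], so only finitely many values below 1
    occur and their maximum is still below 1.\<close>
  define R where "R = max \<bar>x 0\<bar> (int t)"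
  have R: "\<bar>x j\<bar> \<le> R" for j
  proof (induction j)
    case (Suc j)
    then show ?case using digit_orbit_step[OF orb N b_ge(1), of j] unfolding R_def by linarith
  qed (simp add: R_def)
  define V where "V = (\<lambda>z. (cmod (fourier M (of_int z)))\<^sup>2) ` {z. \<bar>z\<bar> \<le> R \<and> z \<noteq> 0}"
  have "{z::int. \<bar>z\<bar> \<le> R \<and> z \<noteq> 0} \<subseteq> {- R..R}" by auto
  then have fin: "finite V" unfolding V_def using finite_subset by blast
  have inV: "(cmod (fourier M (of_int (x n))))\<^sup>2 \<in> V" for n
    unfolding V_def using R[of n] orb unfolding digit_orbit_def by (intro imageI) auto
  then have "V \<noteq> {}" by blast
  have "Max V \<in> V" using fin \<open>V \<noteq> {}\<close> by (rule Max_in)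
  then obtain z :: int where z: "z \<noteq> 0" "Max V = (cmod (fourier M (of_int z)))\<^sup>2" unfolding V_def by blast
  have "Max V < 1" unfolding z(2) using norm_fourier_less_1[of "of_int z"] z(1) by (simp add: power_less_one_iff)
  moreover have "partial_energy n (of_int (x 0)) \<le> Max V" for n
    unfolding energy using fin inV by (intro Max_ge)
  ultimately show ?thesis by blast
qed

text \<open>The set where the limit energy is minimal on a compact interval is invariant under every branch
  of nonzero weight. It contains no non-integer \<open>y\<close>, since it would contain all \<open>y / b ^ n\<close>, and not
  \<open>0\<close>; following branches inside it therefore gives a digit orbit.\<close>

lemma energy_deficit_orbit:
  assumes \<epsilon>: "\<epsilon> > 0" and deficit: "\<And>n. partial_energy n \<xi> \<le> 1 - \<epsilon>"
  shows "\<exists>x. digit_orbit N b t x"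
proof -
  define Q where "Q \<eta> = (SUP n. partial_energy n \<eta>)" for \<eta>
  have bdd: "bdd_above (range (\<lambda>n. partial_energy n \<eta>))" for \<eta>
    using partial_energy_le_1 by (intro bdd_aboveI[of _ 1]) auto
  have Q_ge: "partial_energy n \<eta> \<le> Q \<eta>" for n \<eta>
    unfolding Q_def using bdd by (intro cSUP_upper) auto
  have lim: "(\<lambda>n. partial_energy n \<eta>) \<longlonglongrightarrow> Q \<eta>" for \<eta>
    unfolding Q_def using bdd partial_energy_mono by (intro LIMSEQ_incseq_SUP) (auto simp: incseq_def)
  have Q_fix: "Q \<eta> = (\<Sum>c\<in>centered_digits N. weight \<eta> c * Q (branch \<eta> c))" for \<eta>
  proof -
    have "(\<lambda>n. partial_energy (Suc n) \<eta>) \<longlonglongrightarrow> (\<Sum>c\<in>centered_digits N. weight \<eta> c * Q (branch \<eta> c))"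
      unfolding partial_energy_Suc by (intro tendsto_intros lim)
    moreover have "(\<lambda>n. partial_energy (Suc n) \<eta>) \<longlonglongrightarrow> Q \<eta>" by (rule LIMSEQ_Suc[OF lim])
    ultimately show ?thesis using LIMSEQ_unique by blast
  qed
  \<comment> \<open>Contains \<xi> and is invariant under all branches: |t c| <= t b / 4 <= R b / 4
    and R <= R b / 4.\<close>
  define R where "R = max \<bar>\<xi>\<bar> (real t)"
  define I where "I = {- R..R}"
  have branch_I: "branch \<eta> c \<in> I" if "\<eta> \<in> I" "c \<in> centered_digits N" for \<eta> c
  proof -
    have "2 * \<bar>real_of_int c\<bar> \<le> real N" using that(2) unfolding centered_digits_def by auto
    moreover have "4 * real N \<le> 2 * real b" using b_ge(1) by simp
    ultimately have "4 * \<bar>real_of_int c\<bar> \<le> real b" by linarith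
    then have "real t * (4 * \<bar>real_of_int c\<bar>) \<le> real t * real b" by (intro mult_left_mono) auto
    moreover have "real t * real b \<le> R * real b" unfolding R_def by (intro mult_right_mono) auto
    moreover have "\<bar>\<eta>\<bar> \<le> R" using that(1) unfolding I_def by auto
    moreover have "R * 4 \<le> R * real b" using b_ge(2) unfolding R_def by (intro mult_left_mono) auto
    moreover have "\<bar>real t * real_of_int c\<bar> = real t * \<bar>real_of_int c\<bar>" by (simp add: abs_mult)
    moreover have "\<bar>\<eta> + real t * real_of_int c\<bar> \<le> \<bar>\<eta>\<bar> + \<bar>real t * real_of_int c\<bar>" by (rule abs_triangle_ineq)
    ultimately have "\<bar>\<eta> + real t * real_of_int c\<bar> \<le> R * real b" by linarith
    then have "\<bar>branch \<eta> c\<bar> \<le> R" unfolding branch_def using b_ge(3) by (simp add: abs_divide divide_le_eq)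
    then show ?thesis unfolding I_def by auto
  qed
  have "\<xi> \<in> I" unfolding I_def R_def by auto
  have bddQ: "bdd_below (Q ` I)"
  proof (rule bdd_belowI)
    fix v assume "v \<in> Q ` I"
    then obtain \<eta> where "v = Q \<eta>" by blast
    moreover have "0 \<le> partial_energy 0 \<eta>" unfolding partial_energy_0 by simp
    ultimately show "0 \<le> v" using Q_ge[of 0 \<eta>] by simp
  qed
  define \<alpha> where "\<alpha> = (INF \<eta>\<in>I. Q \<eta>)"
  have \<alpha>_le: "\<alpha> \<le> Q \<eta>" if "\<eta> \<in> I" for \<eta>
    unfolding \<alpha>_def using bddQ that by (intro cINF_lower)
  have "Q \<xi> \<le> 1 - \<epsilon>" unfolding Q_def using deficit by (intro cSUP_least) auto
  then have \<alpha>1: "\<alpha> < 1" using \<alpha>_le[OF \<open>\<xi> \<in> I\<close>] \<epsilon> by linarith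
  define E where "E = {\<eta> \<in> I. Q \<eta> = \<alpha>}"
  \<comment> \<open>As a supremum of continuous functions \<open>Q\<close> is lower semicontinuous.
    The sets \<open>A n\<close> are compact, nonempty and decreasing, and a common point attains
    \<alpha>.\<close>
  have "E \<noteq> {}"
  proof -
    define A where "A n = {\<eta> \<in> I. partial_energy n \<eta> \<le> \<alpha>}" for n
    have "compact (A n)" for n
    proof -
      have "closed (partial_energy n -` {..\<alpha>})"
        by (intro closed_vimage closed_atMost continuous_on_partial_energy)
      then have "compact ({- R..R} \<inter> partial_energy n -` {..\<alpha>})"
        by (intro compact_Int_closed) auto
      moreover have "A n = {- R..R} \<inter> partial_energy n -` {..\<alpha>}" unfolding A_def I_def by auto
      ultimately show ?thesis by simp
    qed
    moreover have "A n \<noteq> {}" for n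
    proof -
      have "compact I" "I \<noteq> {}" using \<open>\<xi> \<in> I\<close> unfolding I_def by auto
      then obtain y where y: "y \<in> I" "\<And>\<eta>. \<eta> \<in> I \<Longrightarrow> partial_energy n y \<le> partial_energy n \<eta>"
        using continuous_attains_inf[of I "partial_energy n", OF _ _ continuous_on_partial_energy] by blast
      have "partial_energy n y \<le> \<alpha>"
        unfolding \<alpha>_def
      proof (rule cINF_greatest)
        show "I \<noteq> {}" by fact
        show "partial_energy n y \<le> Q \<eta>" if "\<eta> \<in> I" for \<eta>
          using y(2)[OF that] Q_ge[of n \<eta>] by linarith
      qed
      then show ?thesis using y(1) unfolding A_def by blast
    qed
    moreover have "A n \<subseteq> A m" if "m \<le> n" for m n
    proof
      fix \<eta> assume "\<eta> \<in> A n"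
      then show "\<eta> \<in> A m" unfolding A_def using partial_energy_mono[OF that, of \<eta>] by simp
    qed
    ultimately have "\<Inter>(range A) \<noteq> {}" by (rule compact_nest)
    then obtain y where y: "\<And>n. y \<in> A n" by blast
    then have "y \<in> I" "\<And>n. partial_energy n y \<le> \<alpha>" unfolding A_def by auto
    then have "Q y \<le> \<alpha>" unfolding Q_def by (intro cSUP_least) auto
    then have "Q y = \<alpha>" using \<alpha>_le[OF \<open>y \<in> I\<close>] by simp
    then show ?thesis using \<open>y \<in> I\<close> unfolding E_def by blast
  qed
  \<comment> \<open>A weighted average of values that are all at least \<alpha> equals \<alpha>, so
    every branch of positive weight attains \<alpha> as well.\<close>
  have invariant: "branch \<eta> c \<in> E" if \<eta>: "\<eta> \<in> E" and c: "c \<in> centered_digits N" "weight \<eta> c \<noteq> 0" for \<eta> c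
  proof -
    have \<eta>': "\<eta> \<in> I" "Q \<eta> = \<alpha>" using \<eta> unfolding E_def by auto
    have "(\<Sum>c\<in>centered_digits N. weight \<eta> c * (Q (branch \<eta> c) - \<alpha>))
        = Q \<eta> - \<alpha> * (\<Sum>c\<in>centered_digits N. weight \<eta> c)"
      unfolding Q_fix[of \<eta>] by (simp add: algebra_simps sum_subtractf sum_distrib_left)
    also have "\<dots> = 0" using \<eta>'(2) sum_weight by simp
    finally have "(\<Sum>c\<in>centered_digits N. weight \<eta> c * (Q (branch \<eta> c) - \<alpha>)) = 0" .
    moreover have "weight \<eta> c * (Q (branch \<eta> c) - \<alpha>) \<ge> 0" if "c \<in> centered_digits N" for c
      using \<alpha>_le[OF branch_I[OF \<eta>'(1) that]] by (intro mult_nonneg_nonneg weight_nonneg) simp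
    ultimately have "weight \<eta> c * (Q (branch \<eta> c) - \<alpha>) = 0"
      using c(1) by (subst (asm) sum_nonneg_eq_0_iff) auto
    then show ?thesis using c branch_I[OF \<eta>'(1) c(1)] unfolding E_def by simp
  qed
  have zero: "0 \<notin> E"
  proof
    assume "0 \<in> E"
    then have "Q 0 = \<alpha>" unfolding E_def by simp
    moreover have "Q 0 \<ge> 1" using Q_ge[of 0 0] unfolding partial_energy_0 by simp
    ultimately show False using \<alpha>1 by simp
  qed
  have ints: "\<eta> \<in> \<int>" if "\<eta> \<in> E" for \<eta>
  proof (rule ccontr)
    assume "\<eta> \<notin> \<int>"
    have tail: "\<eta> / real b ^ n \<in> E \<and> \<eta> / real b ^ n \<notin> \<int>" for n
    proof (induction n)
      case 0
      then show ?case using that \<open>\<eta> \<notin> \<int>\<close> by simp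
    next
      case (Suc n)
      define y where "y = \<eta> / real b ^ n"
      have y: "y \<in> E" "y \<notin> \<int>" using Suc unfolding y_def by auto
      \<comment> \<open>The mask can vanish at y / N only for an integer y, so at a non-integer
        digit 0 survives and leads to y / b, again no integer.\<close>
      have "weight y 0 \<noteq> 0"
      proof
        assume "weight y 0 = 0"
        then have "mask N (y / real N) = 0" unfolding weight_def by simp
        then have "real N * (y / real N) \<in> \<int>" using N by (intro mask_eq_0_imp) auto
        then show False using y(2) N by simp
      qed
      then have "branch y 0 \<in> E" using N by (intro invariant[OF y(1)]) auto
      moreover have "branch y 0 = \<eta> / real b ^ Suc n" unfolding branch_def y_def by simp
      moreover have "branch y 0 \<notin> \<int>"
      proof
        assume "branch y 0 \<in> \<int>"
        then have "real b * branch y 0 \<in> \<int>" by (intro Ints_mult Ints_of_nat)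
        then show False using y(2) b_ge(3) unfolding branch_def by simp
      qed
      ultimately show ?case by simp
    qed
    \<comment> \<open>The points tend to 0, where the level-0 energy tends to 1, although it is
      bounded by \<alpha> < 1 along the sequence.\<close>
    have "real b > 1" using b_ge by simp
    then have lim0: "(\<lambda>n. \<eta> / real b ^ n) \<longlonglongrightarrow> 0" by (rule tendsto_scale_down)
    have "isCont (fourier M) 0"
      using continuous_on_fourier[of UNIV] by (simp add: continuous_on_eq_continuous_at)
    from isCont_tendsto_compose[OF this lim0]
    have "(\<lambda>n. fourier M (\<eta> / real b ^ n)) \<longlonglongrightarrow> fourier M 0" .
    then have "(\<lambda>n. (cmod (fourier M (\<eta> / real b ^ n)))\<^sup>2) \<longlonglongrightarrow> (cmod (fourier M 0))\<^sup>2"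
      by (intro tendsto_intros)
    moreover have "\<exists>n0. \<forall>n\<ge>n0. (cmod (fourier M (\<eta> / real b ^ n)))\<^sup>2 \<le> \<alpha>"
    proof (intro exI[of _ 0] allI impI)
      fix n
      have "Q (\<eta> / real b ^ n) = \<alpha>" using tail[of n] unfolding E_def by blast
      then show "(cmod (fourier M (\<eta> / real b ^ n)))\<^sup>2 \<le> \<alpha>"
        using Q_ge[of 0 "\<eta> / real b ^ n"] unfolding partial_energy_0 by simp
    qed
    ultimately have "(cmod (fourier M 0))\<^sup>2 \<le> \<alpha>" by (rule LIMSEQ_le_const2)
    then show False using \<alpha>1 by simp
  qed
  obtain z0 where "z0 \<in> E" using \<open>E \<noteq> {}\<close> by blast
  obtain x0 where x0: "z0 = real_of_int x0" using ints[OF \<open>z0 \<in> E\<close>] by (rule Ints_cases)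
  have "\<exists>x. \<forall>n. real_of_int (x n) \<in> E \<and> (\<exists>c\<in>centered_digits N. int b * x (Suc n) = x n + int t * c)"
  proof (rule dependent_nat_choice)
    show "\<exists>x. real_of_int x \<in> E" using \<open>z0 \<in> E\<close> unfolding x0 by (rule exI)
    fix x :: int and n :: nat
    assume x: "real_of_int x \<in> E"
    \<comment> \<open>Weights of sum 1 cannot all vanish; the surviving branch ends in
      \<open>E\<close>, hence at an integer, which is the next orbit point.\<close>
    have "\<exists>c\<in>centered_digits N. weight (of_int x) c \<noteq> 0"
    proof (rule ccontr)
      assume "\<not> ?thesis"
      then have "(\<Sum>c\<in>centered_digits N. weight (of_int x) c) = 0" by (intro sum.neutral) auto
      then show False using sum_weight by simp
    qed
    then obtain c where c: "c \<in> centered_digits N" "weight (of_int x) c \<noteq> 0" by blast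
    then have br: "branch (of_int x) c \<in> E" by (intro invariant[OF x])
    obtain y where y: "branch (of_int x) c = real_of_int y" using ints[OF br] by (rule Ints_cases)
    have "real_of_int (int b * y) = real_of_int (x + int t * c)"
      using y b_ge(3) unfolding branch_def by (simp add: field_simps)
    then have "int b * y = x + int t * c" by (simp only: of_int_eq_iff)
    then show "\<exists>y. real_of_int y \<in> E \<and> (\<exists>c\<in>centered_digits N. int b * y = x + int t * c)"
      using c(1) br unfolding y by blast
  qed
  then obtain x where x: "\<And>n. real_of_int (x n) \<in> E"
      "\<And>n. \<exists>c\<in>centered_digits N. int b * x (Suc n) = x n + int t * c" by blast
  have "x n \<noteq> 0" for n
  proof
    assume "x n = 0"
    then show False using x(1)[of n] zero by simp
  qed
  then show ?thesis unfolding digit_orbit_def using x(2) by blast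
qed

text \<open>Orthogonality holds in any case, so Parseval alone decides: an orbit leaves a deficit at
  one frequency, and a deficit at any frequency produces an orbit.\<close>

theorem complete_number_iff_no_orbit:
  assumes K: "compact K" "measure M K = 1"
    and C: "C = real_of_int ` centered_digits N"
  shows "complete_number M (radix_expansions (real b) C) (real t) \<longleftrightarrow> (\<nexists>x. digit_orbit N b t x)"
proof -
  define \<Lambda> where "\<Lambda> = (\<lambda>l. real t * l) ` radix_expansions (real b) C"
  have \<Lambda>: "\<Lambda> = (\<lambda>l. real t * of_int l) ` (\<Union>n. radix_sums N b n)"
  proof -
    have "radix_expansions (real b) C = real_of_int ` (\<Union>n. radix_sums N b n)"
      by (rule radix_expansions_eq[OF C]) (use N in simp)
    then show ?thesis unfolding \<Lambda>_def by (simp only: image_image)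
  qed
  have mono: "radix_sums N b m \<subseteq> radix_sums N b (max m n)" "radix_sums N b n \<subseteq> radix_sums N b (max m n)" for m n
    by (rule radix_sums_mono; use N in simp)+
  have inj: "inj (\<lambda>l. real t * of_int l)" using t(1) by (auto simp: inj_on_def)
  \<comment> \<open>The basis criterion evaluates at \<xi> - i, the energies at \<xi> + i; the
    modulus of the transform is even, so they differ by the sign of \<xi>.\<close>
  have energy: "(\<Sum>i\<in>(\<lambda>l. real t * of_int l) ` radix_sums N b n. (cmod (fourier M (\<xi> - i)))\<^sup>2)
      = partial_energy n (- \<xi>)" for n \<xi>
  proof -
    have "cmod (fourier M (\<xi> - i)) = cmod (fourier M (- \<xi> + i))" for i
      using norm_fourier_minus[of "\<xi> - i"] by simp
    then show ?thesis unfolding partial_energy_def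
      by (subst sum.reindex[OF inj_on_subset[OF inj]]) auto
  qed
  have "spectral_pair M \<Lambda> \<longleftrightarrow> (\<nexists>x. digit_orbit N b t x)"
  proof
    assume sp: "spectral_pair M \<Lambda>"
    show "\<nexists>x. digit_orbit N b t x"
    proof
      assume "\<exists>x. digit_orbit N b t x"
      then obtain x where "digit_orbit N b t x" by blast
      from orbit_energy_deficit[OF this]
      obtain \<kappa> where x: "\<kappa> < 1" "\<And>n. partial_energy n (of_int (x 0)) \<le> \<kappa>" by blast
      obtain F where F: "finite F" "F \<subseteq> \<Lambda>" "(\<Sum>i\<in>F. (cmod (fourier M (- of_int (x 0) - i)))\<^sup>2) > 1 - (1 - \<kappa>)"
        using spectral_pair_parseval[OF sp, of "1 - \<kappa>" "- of_int (x 0)"] x(1) by auto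
      \<comment> \<open>The levels increase, so a finite part of their union lies in one of
        them.\<close>
      have "\<exists>n. F \<subseteq> (\<lambda>l. real t * of_int l) ` radix_sums N b n"
        using F(1,2)
      proof (induction F rule: finite_induct)
        case (insert i F)
        then obtain n where n: "F \<subseteq> (\<lambda>l. real t * of_int l) ` radix_sums N b n" by auto
        have "i \<in> (\<lambda>l. real t * of_int l) ` (\<Union>n. radix_sums N b n)" using insert.prems unfolding \<Lambda> by simp
        then obtain m l where m: "l \<in> radix_sums N b m" "i = real t * of_int l" by blast
        have "F \<subseteq> (\<lambda>l. real t * of_int l) ` radix_sums N b (max m n)"
          using n image_mono[OF mono(2)] by (rule order.trans)
        moreover have "i \<in> (\<lambda>l. real t * of_int l) ` radix_sums N b (max m n)"
          unfolding m(2) using subsetD[OF mono(1) m(1)] by (rule imageI)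
        ultimately have "insert i F \<subseteq> (\<lambda>l. real t * of_int l) ` radix_sums N b (max m n)" by simp
        then show ?case by (rule exI)
      qed simp
      then obtain n where n: "F \<subseteq> (\<lambda>l. real t * of_int l) ` radix_sums N b n" by blast
      have "(\<Sum>i\<in>F. (cmod (fourier M (- of_int (x 0) - i)))\<^sup>2)
          \<le> (\<Sum>i\<in>(\<lambda>l. real t * of_int l) ` radix_sums N b n. (cmod (fourier M (- of_int (x 0) - i)))\<^sup>2)"
        using n by (intro sum_mono2) auto
      also have "\<dots> = partial_energy n (of_int (x 0))" unfolding energy by simp
      also have "\<dots> \<le> \<kappa>" by (rule x(2))
      finally show False using F(3) by simp
    qed
  next
    assume no: "\<nexists>x. digit_orbit N b t x"
    show "spectral_pair M \<Lambda>"
    proof (rule spectral_pairI[OF K])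
      show "countable \<Lambda>" unfolding \<Lambda> by (intro countable_image countableI_type)
      fix i j assume ij: "i \<in> \<Lambda>" "j \<in> \<Lambda>" "i \<noteq> j"
      obtain m l where m: "l \<in> radix_sums N b m" "i = real t * of_int l" using ij(1) unfolding \<Lambda> by blast
      obtain n k where n: "k \<in> radix_sums N b n" "j = real t * of_int k" using ij(2) unfolding \<Lambda> by blast
      have "l \<in> radix_sums N b (max m n)" "k \<in> radix_sums N b (max m n)"
        using subsetD[OF mono(1) m(1)] subsetD[OF mono(2) n(1)] .
      then show "fourier M (i - j) = 0"
        unfolding m(2) n(2) by (rule fourier_orthogonal) (use ij(3) m n in auto)
    next
      fix \<xi> \<epsilon> :: real assume \<epsilon>: "\<epsilon> > 0"
      have "\<exists>n. partial_energy n (- \<xi>) > 1 - \<epsilon>"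
      proof (rule ccontr)
        assume "\<not> ?thesis"
        then have "\<And>n. partial_energy n (- \<xi>) \<le> 1 - \<epsilon>" by (simp add: not_less)
        then show False using energy_deficit_orbit[OF \<epsilon>] no by blast
      qed
      then obtain n where "partial_energy n (- \<xi>) > 1 - \<epsilon>" by blast
      then show "\<exists>F. finite F \<and> F \<subseteq> \<Lambda> \<and> (\<Sum>i\<in>F. (cmod (fourier M (\<xi> - i)))\<^sup>2) > 1 - \<epsilon>"
        unfolding energy[symmetric] \<Lambda>
        by (intro exI[of _ "(\<lambda>l. real t * of_int l) ` radix_sums N b n"]) auto
    qed
  qed
  then show ?thesis unfolding complete_number_def \<Lambda>_def .
qed

end

theorem theorem1p9:
  fixes N q b m :: nat and D C :: "real set" and p l :: "nat \<Rightarrow> nat"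
  assumes "N \<ge> 2" and "q \<ge> 2" and "b = q * N"
    and "D = real ` {0..N - 1}"
    and "C = {- (real N / 2)<..real N / 2} \<inter> \<int>"
    and "inj_on p {1..m}"
    and "\<And>i. i \<in> {1..m} \<Longrightarrow> prime (p i) \<and> p i \<ge> 2 * N + 1"
    and "coprime (\<Prod>i=1..m. p i) b"
    and "\<And>i. i \<in> {1..m} \<Longrightarrow> l i = multiplicity (p i) (LCM j\<in>{1..m}. ord (p j) b)"
    and "complete_number (self_similar_measure (real b) ((\<lambda>d. real q * d) ` D))
           (radix_expansions (real b) C)
           (real (\<Prod>i=1..m. p i ^ (order_stability b (p i) + l i)))"
  shows "\<forall>k :: nat \<Rightarrow> nat.
           complete_number (self_similar_measure (real b) ((\<lambda>d. real q * d) ` D))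
             (radix_expansions (real b) C)
             (real (\<Prod>i=1..m. p i ^ k i))"
proof
  fix k :: "nat \<Rightarrow> nat"
  define M where "M = self_similar_measure (real b) ((\<lambda>d. real q * d) ` D)"
  define t\<^sub>0 where "t\<^sub>0 = (\<Prod>i=1..m. p i ^ (order_stability b (p i) + l i))"
  define t where "t = (\<Prod>i=1..m. p i ^ k i)"
  have b: "b \<ge> 2 * N" unfolding assms(3) using assms(2) by (intro mult_right_mono) auto
  have b1: "real b > 1" using b assms(1) by linarith
  have D: "finite ((\<lambda>d. real q * d) ` D)" "(\<lambda>d. real q * d) ` D \<noteq> {}"
    unfolding assms(4) by auto
  have self_similar: "is_self_similar_measure (real b) ((\<lambda>d. real q * d) ` D) M"
    unfolding M_def using D b1 by (rule is_self_similar_measure_self_similar_measure)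
  \<comment> \<open>N >= 2 turns p i >= 2N + 1 into the bound 5 that the arc argument needs.\<close>
  have pr: "prime (p i)" "p i \<ge> 5" if "i \<in> {1..m}" for i
    using assms(7)[OF that] assms(1) by linarith+
  have cop: "coprime (p i) b" if "i \<in> {1..m}" for i
    by (rule coprime_divisors[OF dvd_prodI[OF finite_atLeastAtMost that] dvd_refl assms(8)])
  \<comment> \<open>Stated for arbitrary exponents, so that it covers the threshold product and the
    given one alike.\<close>
  have pair: "cantor_pair M N q b (\<Prod>i=1..m. p i ^ e i)" for e
    unfolding cantor_pair_def cantor_pair_axioms_def
  proof (intro conjI)
    show "real_distribution M" by (rule real_distribution_self_similar[OF self_similar])
    show "0 < (\<Prod>i=1..m. p i ^ e i)"
      using pr(1) prime_gt_0_nat by (intro prod_pos zero_less_power) blast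
    show "coprime (\<Prod>i=1..m. p i ^ e i) b"
      using cop by (intro prod_coprime_left) simp
    show "is_self_similar_measure (real b) ((\<lambda>d. real q * d) ` real ` {0..N - 1}) M"
      using self_similar unfolding assms(4) .
  qed (use assms(1-3) in simp_all)
  have C: "C = real_of_int ` centered_digits N"
  proof (intro equalityI subsetI)
    fix x assume "x \<in> C"
    then obtain c where c: "x = real_of_int c" "- (real N / 2) < real_of_int c" "real_of_int c \<le> real N / 2"
      unfolding assms(5) by (auto elim: Ints_cases)
    then have "real_of_int (- int N) < real_of_int (2 * c)" "real_of_int (2 * c) \<le> real_of_int (int N)"
      by simp_all
    then have "c \<in> centered_digits N" unfolding centered_digits_def of_int_less_iff of_int_le_iff by simp
    then show "x \<in> real_of_int ` centered_digits N" unfolding c(1) by (rule imageI)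
  next
    fix x assume "x \<in> real_of_int ` centered_digits N"
    then obtain c where c: "x = real_of_int c" "- int N < 2 * c" "2 * c \<le> int N"
      unfolding centered_digits_def by blast
    have "- real N < 2 * real_of_int c" "2 * real_of_int c \<le> real N" using c(2,3) by linarith+
    then show "x \<in> C" unfolding assms(5) c(1) by auto
  qed
  have complete: "complete_number M (radix_expansions (real b) C) (real t\<^sub>0)"
    using assms(10) unfolding M_def t\<^sub>0_def .
  \<comment> \<open>The completeness hypothesis also supplies the compact carrier of the measure,
    which does not depend on the exponents.\<close>
  then obtain K where K: "compact K" "measure M K = 1"
    unfolding complete_number_def spectral_pair_def by blast
  have "\<nexists>x. digit_orbit N b t\<^sub>0 x"
    using complete unfolding t\<^sub>0_def cantor_pair.complete_number_iff_no_orbit[OF pair K C] .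
  moreover have t\<^sub>0: "t\<^sub>0 = (\<Prod>i\<in>{1..m}. p i ^ (order_stability b (p i)
      + multiplicity (p i) (LCM j\<in>{1..m}. ord (p j) b)))"
    unfolding t\<^sub>0_def by (intro prod.cong refl) (simp only: assms(9))
  moreover have "\<exists>x. digit_orbit N b t\<^sub>0 x" if "digit_orbit N b t x" for x
    using that unfolding t_def t\<^sub>0
    by - (rule digit_orbit_reduce[OF assms(1) b finite_atLeastAtMost assms(6) pr(1) cop pr(2)]; assumption)
  ultimately have "\<nexists>x. digit_orbit N b t x" by blast
  then show "complete_number (self_similar_measure (real b) ((\<lambda>d. real q * d) ` D))
      (radix_expansions (real b) C) (real (\<Prod>i=1..m. p i ^ k i))"
    unfolding M_def[symmetric] cantor_pair.complete_number_iff_no_orbit[OF pair K C] t_def .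
qed

end
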